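(* The reproducing kernel for $\mathcal{M}^2_\omega(\mathcal{R})$ is given by $$K(z,w)=\frac1{2\pi}\,\frac{\Gamma(z+\overline w)}{2^{z+\overline w}},\qquad z,w\in\mathcal{R}.$$
   Context: $\mathcal{R}=\{z\in\mathbf{C}:\Re z>0\}$ and $\overline{\mathcal{R}}$ is its closure. For $0<b<\infty$, $S_b=\{x+iy:0<x<b\}$ and $H^2(S_b)$ is the space of holomorphic $f$ on $S_b$ with $\sup_{0<x<b}\int_{-\infty}^{+\infty}|f(x+iy)|^2\,dy<\infty$; for such $f$ the functions $f(x+i\cdot)$ have a limit in $L^2(\mathbf{R})$ as $x\to0^+$ (boundary values on the imaginary axis). Let $\omega=\sum_{n=0}^{+\infty}\frac{2^n}{n!}\,\delta_{n/2}(x)\otimes dy$ be the Borel measure on $\overline{\mathcal{R}}$. The space $\mathcal{M}^2_\omega(\mathcal{R})$ consists of the holomorphic functions $f$ on $\mathcal{R}$ such that $f\in H^2(S_b)$ for every $0<b<\infty$ and $f\in L^2(\overline{\mathcal{R}},d\omega)$ (with $f$ on the imaginary axis understood as its boundary values); it is a Hilbert space with inner product $\langle f,g\rangle=\sum_{n\ge0}\frac{2^n}{n!}\int_{-\infty}^{+\infty}f(\frac n2+iy)\overline{g(\frac n2+iy)}\,dy$. The reproducing kernel is the function $K$ such that $K(\cdot,w)\in\mathcal{M}^2_\omega(\mathcal{R})$ and $f(w)=\langle f,K(\cdot,w)\rangle$ for all $w\in\mathcal{R}$ and all $f$ in the space. *)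

theory Defs
  imports "HOL-Complex_Analysis.Complex_Analysis" "HOL-Probability.Probability"
begin

definition right_halfplane :: "complex set" where
  "right_halfplane = {z. Re z > 0}"

definition strip :: "real \<Rightarrow> complex set" where
  "strip b = {z. 0 < Re z \<and> Re z < b}"

definition hardy2_strip :: "real \<Rightarrow> (complex \<Rightarrow> complex) set" where
  "hardy2_strip b =
     {f. f holomorphic_on strip b \<and>
         (SUP x\<in>{0<..<b}. \<integral>\<^sup>+ y. ennreal ((norm (f (Complex x y)))\<^sup>2) \<partial>lborel) < \<infinity>}"

definition L2 :: "'a measure \<Rightarrow> ('a \<Rightarrow> complex) set" where
  "L2 M = {f \<in> borel_measurable M. (\<integral>\<^sup>+ x. ennreal ((norm (f x))\<^sup>2) \<partial>M) < \<infinity>}"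

definition is_boundary_value :: "(complex \<Rightarrow> complex) \<Rightarrow> (real \<Rightarrow> complex) \<Rightarrow> bool" where
  "is_boundary_value f g \<longleftrightarrow>
     g \<in> L2 lborel \<and>
     ((\<lambda>x. \<integral>\<^sup>+ y. ennreal ((norm (f (Complex x y) - g y))\<^sup>2) \<partial>lborel) \<longlongrightarrow> 0) (at_right 0)"

text \<open>
  Functions in \<^term>\<open>hardy2_strip b\<close> have boundary values, unique up to a null set. The choice of
  representative affects neither membership in \<open>L2 omega\<close> nor the inner product below.
\<close>

definition boundary_value :: "(complex \<Rightarrow> complex) \<Rightarrow> real \<Rightarrow> complex" where
  "boundary_value f = (SOME g. is_boundary_value f g)"

text \<open>
  A holomorphic function on the open half-plane is only relevant through its values there; values
  that the HOL function happens to take on the imaginary axis are replaced by the boundary values.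
\<close>

definition bd_extend :: "(complex \<Rightarrow> complex) \<Rightarrow> complex \<Rightarrow> complex" where
  "bd_extend f z = (if Re z > 0 then f z else if Re z = 0 then boundary_value f (Im z) else 0)"

text \<open>
  The measure \<open>\<Sum>n. 2 ^ n / n! \<cdot> \<delta>(n/2) \<otimes> dy\<close>, as a Borel measure on the whole complex plane that
  vanishes outside the closed right half-plane; the first component is the image of the weighted
  counting measure under \<open>n \<mapsto> n / 2\<close>.
\<close>

definition omega_x :: "real measure" where
  "omega_x = distr (point_measure UNIV (\<lambda>n::nat. ennreal (2 ^ n / fact n))) borel (\<lambda>n. real n / 2)"

definition omega :: "complex measure" where
  "omega = distr (omega_x \<Otimes>\<^sub>M lborel) borel (\<lambda>(x, y). Complex x y)"

lemma measurable_Complex [measurable]: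
  "(\<lambda>(x, y). Complex x y) \<in> borel_measurable (borel \<Otimes>\<^sub>M borel)"
proof -
  have "(\<lambda>(x, y). Complex x y) = (\<lambda>p. complex_of_real (fst p) + \<i> * complex_of_real (snd p))"
    by (auto simp: complex_eq_iff)
  then show ?thesis by simp
qed

lemma sets_omega_x [measurable_cong]: "sets omega_x = sets borel"
  by (simp add: omega_x_def)

lemma nn_integral_omega:
  assumes [measurable]: "F \<in> borel_measurable borel"
  shows "(\<integral>\<^sup>+ z. F z \<partial>omega) =
    (\<Sum>n. ennreal (2 ^ n / fact n) * (\<integral>\<^sup>+ y. F (Complex (real n / 2) y) \<partial>lborel))"
proof -
  have [measurable]: "(\<lambda>p. F (Complex (fst p) (snd p))) \<in> borel_measurable (borel \<Otimes>\<^sub>M borel)"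
    using measurable_compose[OF measurable_Complex assms] by (simp add: case_prod_beta)
  have [measurable]: "(\<lambda>p. F (Complex (fst p) (snd p))) \<in> borel_measurable (omega_x \<Otimes>\<^sub>M lborel)"
    by measurable
  have m: "(\<lambda>(x, y). Complex x y) \<in> measurable (omega_x \<Otimes>\<^sub>M lborel) borel"
    by measurable
  have m2: "(\<lambda>x. \<integral>\<^sup>+ y. F (Complex x y) \<partial>lborel) \<in> borel_measurable borel"
    using lborel.borel_measurable_nn_integral_fst[of "\<lambda>p. F (Complex (fst p) (snd p))" borel]
    by simp
  have "(\<integral>\<^sup>+ z. F z \<partial>omega) =
      (\<integral>\<^sup>+ p. F (Complex (fst p) (snd p)) \<partial>(omega_x \<Otimes>\<^sub>M lborel))"
    unfolding omega_def by (subst nn_integral_distr[OF m]) (simp_all add: case_prod_beta)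
  also have "\<dots> = (\<integral>\<^sup>+ x. \<integral>\<^sup>+ y. F (Complex x y) \<partial>lborel \<partial>omega_x)"
    by (subst lborel.nn_integral_fst[symmetric]) simp_all
  also have "\<dots> = (\<integral>\<^sup>+ n. \<integral>\<^sup>+ y. F (Complex (real n / 2) y) \<partial>lborel
      \<partial>point_measure UNIV (\<lambda>n::nat. ennreal (2 ^ n / fact n)))"
    unfolding omega_x_def
    by (subst nn_integral_distr) (simp_all add: m2 point_measure_def)
  also have "\<dots> = (\<Sum>n. ennreal (2 ^ n / fact n) * (\<integral>\<^sup>+ y. F (Complex (real n / 2) y) \<partial>lborel))"
    unfolding point_measure_def
    by (subst nn_integral_density) (simp_all add: nn_integral_count_space_nat)
  finally show ?thesis .
qed

definition M2_omega :: "(complex \<Rightarrow> complex) set" where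
  "M2_omega = {f. f holomorphic_on right_halfplane \<and>
                  (\<forall>b>0. f \<in> hardy2_strip b) \<and>
                  bd_extend f \<in> L2 omega}"

definition inner_omega :: "(complex \<Rightarrow> complex) \<Rightarrow> (complex \<Rightarrow> complex) \<Rightarrow> complex" where
  "inner_omega f g =
     (\<Sum>n. 2 ^ n / fact n *
        (LINT y|lborel. bd_extend f (Complex (real n / 2) y) *
                        cnj (bd_extend g (Complex (real n / 2) y))))"

definition is_reproducing_kernel :: "(complex \<Rightarrow> complex \<Rightarrow> complex) \<Rightarrow> bool" where
  "is_reproducing_kernel K \<longleftrightarrow>
     (\<forall>w\<in>right_halfplane. (\<lambda>z. K z w) \<in> M2_omega \<and>
        (\<forall>f\<in>M2_omega. f w = inner_omega f (\<lambda>z. K z w)))"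

end

theory Submission
  imports Defs
begin

text \<open>
  Let \<open>f\<close> be holomorphic on the right half-plane and in the Hardy space of every strip, and put
  \<open>k(s) = Gamma s / (2 pi 2^s)\<close> (\<open>gamma_kernel\<close>). On the line \<open>Re z = n/2\<close> the conjugate of \<open>k(z + cnj w)\<close> is
  \<open>k(w + n - z)\<close>, so the \<open>n\<close>-th term of the inner product of \<open>f\<close> with \<open>k(\<cdot> + cnj w)\<close> is a line integral of the holomorphic
  function \<open>2^n/n! f(z) k(w + n - z)\<close>. No pole lies between \<open>Re z = n/2\<close> and a line \<open>Re z = c\<close>
  with small \<open>c > 0\<close>, so all terms can be moved to this common line
  (\<open>omega_term_gamma_kernel\<close>). There the first \<open>N + 1\<close> of them add up in closed form,

    \<open>(\<Sum>n\<le>N. 2^n/n! k(a + n)) = 2^(N+1)/N! k(a + N + 1) / a\<close>  with  \<open>a = w - z\<close>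

  (\<open>sum_gamma_kernel\<close>). To the left of \<open>Re z = Re w + N + 1\<close> the only singularity of this
  is a simple pole at \<open>z = w\<close>. Moving the line on to \<open>Re z = Re w + 1\<close> produces the residue
  \<open>f(w)\<close>, and the remaining integral is \<open>O(1/N)\<close> because \<open>Gamma N / N! = 1 / N\<close>. Hence the
  series of inner products converges to \<open>f(w)\<close> (\<open>omega_term_gamma_kernel_sums\<close>).

  Two facts on Hardy functions of a strip support this. Vertical lines of integration may be
  shifted under uniform bounds on the line integrals, since the horizontal edges of the rectangles are then
  integrable in their height (\<open>vertical_line_integrals_differ\<close>). And the boundary values on the
  imaginary axis exist (\<open>hardy2_strip_has_boundary_value\<close>): by the same shift, the inner product of the traces of
  \<open>f\<close> on \<open>Re z = x\<close> and \<open>Re z = x'\<close> is a function of \<open>x + x'\<close>, which makes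
  the squared norm of the trace a bounded midpoint convex function of \<open>x\<close>, and the existence of its limit at \<open>0\<close> is
  equivalent to the traces being Cauchy in \<open>L\<^sup>2\<close>.

  The formula for \<open>f(w)\<close>, applied to the kernel function itself, also shows that its norm is
  finite. Uniqueness of the kernel is the usual argument: two reproducing kernels are
  compared through their inner product, which each of them evaluates.
\<close>

section \<open>Shifting vertical lines of integration\<close>

lemma has_contour_integral_horizontal:
  assumes "c < d"
  shows "(h has_contour_integral I) (linepath (Complex c T) (Complex d T)) \<longleftrightarrow>
    ((\<lambda>x. h (Complex x T)) has_integral I) {c..d}"
proof -
  have "((\<lambda>x. h (Complex x T)) has_integral I) (cbox c d) \<longleftrightarrow>
      ((\<lambda>t. h (Complex ((d - c) * t + c) T)) has_integral I /\<^sub>R (d - c)) {0..1}"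
    by (subst has_integral_affinity_iff[of "d - c" _ "c", symmetric])
       (insert assms, simp_all add: field_simps)
  also have "(\<lambda>t. h (Complex ((d - c) * t + c) T)) =
      (\<lambda>t. (h (linepath (Complex c T) (Complex d T) t) * (Complex d T - Complex c T)) /\<^sub>R (d - c))"
  proof
    fix t :: real
    have "linepath (Complex c T) (Complex d T) t = Complex ((d - c) * t + c) T"
      by (simp add: linepath_def complex_eq_iff algebra_simps)
    moreover have "Complex d T - Complex c T = of_real (d - c)" by (simp add: complex_eq_iff)
    ultimately show "h (Complex ((d - c) * t + c) T) =
      (h (linepath (Complex c T) (Complex d T) t) * (Complex d T - Complex c T)) /\<^sub>R (d - c)"
      using assms by (simp add: scaleR_conv_of_real del: of_real_diff)
  qed
  also have "(\<dots> has_integral I /\<^sub>R (d - c)) {0..1} \<longleftrightarrow>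
      ((\<lambda>t. h (linepath (Complex c T) (Complex d T) t) * (Complex d T - Complex c T)) has_integral I) {0..1}"
    using assms by (subst has_integral_cmul_iff) auto
  finally show ?thesis by (simp add: has_contour_integral_linepath)
qed

lemma has_contour_integral_vertical:
  assumes "S < T"
  shows "(h has_contour_integral \<i> * I) (linepath (Complex x S) (Complex x T)) \<longleftrightarrow>
    ((\<lambda>y. h (Complex x y)) has_integral I) {S..T}"
proof -
  have "((\<lambda>y. h (Complex x y)) has_integral I) (cbox S T) \<longleftrightarrow>
      ((\<lambda>t. h (Complex x ((T - S) * t + S))) has_integral I /\<^sub>R (T - S)) {0..1}"
    by (subst has_integral_affinity_iff[of "T - S" _ "S", symmetric])
       (insert assms, simp_all add: field_simps)
  also have "(\<lambda>t. h (Complex x ((T - S) * t + S))) =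
      (\<lambda>t. (h (linepath (Complex x S) (Complex x T) t) * (Complex x T - Complex x S) / \<i>) /\<^sub>R (T - S))"
  proof
    fix t :: real
    have "linepath (Complex x S) (Complex x T) t = Complex x ((T - S) * t + S)"
      by (simp add: linepath_def complex_eq_iff algebra_simps)
    moreover have "Complex x T - Complex x S = \<i> * of_real (T - S)" by (simp add: complex_eq_iff)
    moreover have "complex_of_real (T - S) \<noteq> 0" using assms by simp
    ultimately show "h (Complex x ((T - S) * t + S)) =
      (h (linepath (Complex x S) (Complex x T) t) * (Complex x T - Complex x S) / \<i>) /\<^sub>R (T - S)"
      by (simp add: scaleR_conv_of_real field_simps del: of_real_diff)
  qed
  also have "(\<dots> has_integral I /\<^sub>R (T - S)) {0..1} \<longleftrightarrow>
      ((\<lambda>t. h (linepath (Complex x S) (Complex x T) t) * (Complex x T - Complex x S) / \<i>) has_integral I) {0..1}"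
    using assms by (subst has_integral_cmul_iff) auto
  also have "\<dots> \<longleftrightarrow> ((\<lambda>t. h (linepath (Complex x S) (Complex x T) t) * (Complex x T - Complex x S)) has_integral \<i> * I) {0..1}"
  proof
    assume "((\<lambda>t. h (linepath (Complex x S) (Complex x T) t) * (Complex x T - Complex x S) / \<i>) has_integral I) {0..1}"
    from has_integral_mult_right[OF this, of \<i>]
    show "((\<lambda>t. h (linepath (Complex x S) (Complex x T) t) * (Complex x T - Complex x S)) has_integral \<i> * I) {0..1}"
      by simp
  next
    assume "((\<lambda>t. h (linepath (Complex x S) (Complex x T) t) * (Complex x T - Complex x S)) has_integral \<i> * I) {0..1}"
    from has_integral_mult_right[OF this, of "1/\<i>"]
    show "((\<lambda>t. h (linepath (Complex x S) (Complex x T) t) * (Complex x T - Complex x S) / \<i>) has_integral I) {0..1}"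
      by simp
  qed
  finally show ?thesis by (simp add: has_contour_integral_linepath)
qed

lemma rectangle_contour_integral:
  assumes "c < d" "0 < T"
    and cont: "continuous_on (path_image (rectpath (Complex c (-T)) (Complex d T))) h"
  shows "contour_integral (rectpath (Complex c (-T)) (Complex d T)) h =
     integral {c..d} (\<lambda>x. h (Complex x (-T))) - integral {c..d} (\<lambda>x. h (Complex x T))
     + \<i> * (integral {-T..T} (\<lambda>y. h (Complex d y)) - integral {-T..T} (\<lambda>y. h (Complex c y)))"
proof -
  define p where "p = path_image (rectpath (Complex c (-T)) (Complex d T))"
  have p: "p = {z. (Re z = c \<or> Re z = d) \<and> -T \<le> Im z \<and> Im z \<le> T \<or> (Im z = -T \<or> Im z = T) \<and> c \<le> Re z \<and> Re z \<le> d}"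
    unfolding p_def using assms by (subst path_image_rectpath) auto
  have h: "(\<lambda>x. h (Complex x t)) integrable_on {c..d}" if "t = T \<or> t = -T" for t
    using that by (intro integrable_continuous_interval continuous_on_compose2[OF cont[folded p_def]])
       (auto simp: p Complex_eq intro!: continuous_intros)
  have v: "(\<lambda>y. h (Complex x y)) integrable_on {-T..T}" if "x = c \<or> x = d" for x
    using that by (intro integrable_continuous_interval continuous_on_compose2[OF cont[folded p_def]])
       (auto simp: p Complex_eq intro!: continuous_intros)
  have 1: "(h has_contour_integral integral {c..d} (\<lambda>x. h (Complex x t))) (linepath (Complex c t) (Complex d t))"
    if "t = T \<or> t = -T" for t
    using h[OF that] by (simp add: has_contour_integral_horizontal[OF assms(1)] integrable_integral)
  have 2: "(h has_contour_integral \<i> * integral {-T..T} (\<lambda>y. h (Complex x y))) (linepath (Complex x (-T)) (Complex x T))"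
    if "x = c \<or> x = d" for x
    using v[OF that] assms by (subst has_contour_integral_vertical) (auto simp: integrable_integral)
  have 3: "(h has_contour_integral - integral {c..d} (\<lambda>x. h (Complex x T))) (linepath (Complex d T) (Complex c T))"
    using has_contour_integral_reversepath[OF _ 1[of T]] by simp
  have 4: "(h has_contour_integral - (\<i> * integral {-T..T} (\<lambda>y. h (Complex c y)))) (linepath (Complex c T) (Complex c (-T)))"
    using has_contour_integral_reversepath[OF _ 2[of c]] by simp
  have "(h has_contour_integral (integral {c..d} (\<lambda>x. h (Complex x (-T))) +
     (\<i> * integral {-T..T} (\<lambda>y. h (Complex d y)) + (- integral {c..d} (\<lambda>x. h (Complex x T))
      + - (\<i> * integral {-T..T} (\<lambda>y. h (Complex c y)))))))
     (rectpath (Complex c (-T)) (Complex d T))"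
    unfolding rectpath_def Let_def
    using 1[of "-T"] 2[of d] 3 4 by (intro has_contour_integral_join) auto
  from contour_integral_unique[OF this] show ?thesis by (simp add: algebra_simps)
qed

lemma continuous_vertical_line:
  assumes "continuous_on A h" "\<And>y. Complex x y \<in> A"
  shows "continuous_on UNIV (\<lambda>y. h (Complex x y))"
  by (rule continuous_on_compose2[OF assms(1)]) (auto simp: Complex_eq assms(2)[unfolded Complex_eq] intro!: continuous_intros)

lemma truncated_integral_tendsto:
  fixes u :: "real \<Rightarrow> complex"
  assumes "integrable lborel u"
  shows "((\<lambda>T. integral {-T..T} u) \<longlongrightarrow> (LINT y|lborel. u y)) at_top"
proof -
  have [measurable]: "u \<in> borel_measurable borel" using assms by (simp add: integrable_iff_bounded)
  have "((\<lambda>T. LINT y|lborel. indicator {-T..T} y *\<^sub>R u y) \<longlongrightarrow> (LINT y|lborel. u y)) at_top"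
  proof (rule integral_dominated_convergence_at_top[where w = "\<lambda>y. norm (u y)"])
    show "AE y in lborel. ((\<lambda>T. indicator {-T..T} y *\<^sub>R u y) \<longlongrightarrow> u y) at_top"
    proof (rule AE_I2)
      fix y :: real
      have "eventually (\<lambda>T. indicator {-T..T} y *\<^sub>R u y = u y) at_top"
        using eventually_ge_at_top[of "\<bar>y\<bar>"] by eventually_elim (auto simp: indicator_def)
      then show "((\<lambda>T. indicator {-T..T} y *\<^sub>R u y) \<longlongrightarrow> u y) at_top"
        by (simp add: tendsto_eventually)
    qed
  qed (use assms in \<open>auto simp: indicator_def\<close>)
  moreover have "(LINT y|lborel. indicator {-T..T} y *\<^sub>R u y) = integral {-T..T} u" for T
  proof -
    have "set_integrable lborel {-T..T} u"
      unfolding set_integrable_def using assms by (intro integrable_mult_indicator) auto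
    from set_borel_integral_eq_integral(2)[OF this] show ?thesis
      by (simp add: set_lebesgue_integral_def)
  qed
  ultimately show ?thesis by simp
qed

lemma norm_integral_le_nn_integral:
  fixes u :: "real \<Rightarrow> complex"
  assumes "continuous_on {c..d} u"
  shows "ennreal (norm (integral {c..d} u)) \<le> (\<integral>\<^sup>+ x. ennreal (norm (u x)) * indicator {c..d} x \<partial>lborel)"
proof -
  have si: "set_integrable lborel {c..d} u"
    using borel_integrable_atLeastAtMost'[OF assms] .
  have "ennreal (norm (integral {c..d} u)) = ennreal (norm (LINT x|lborel. indicator {c..d} x *\<^sub>R u x))"
    using set_borel_integral_eq_integral(2)[OF si] by (simp add: set_lebesgue_integral_def)
  also have "\<dots> \<le> (\<integral>\<^sup>+ x. ennreal (norm (indicator {c..d} x *\<^sub>R u x)) \<partial>lborel)"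
    using si unfolding set_integrable_def by (rule integral_norm_bound_ennreal)
  also have "\<dots> = (\<integral>\<^sup>+ x. ennreal (norm (u x)) * indicator {c..d} x \<partial>lborel)"
    by (intro nn_integral_cong) (auto simp: indicator_def)
  finally show ?thesis .
qed

lemma emeasure_lborel_atLeast: "emeasure lborel {a::real..} = \<infinity>"
proof -
  have *: "of_nat n \<le> emeasure lborel {a..}" for n
    using emeasure_mono[of "{a..a + real n}" "{a..}" lborel] by (simp add: ennreal_of_nat_eq_real_of_nat)
  show ?thesis
  proof (rule ccontr)
    assume "emeasure lborel {a..} \<noteq> \<infinity>"
    then obtain n where "emeasure lborel {a..} < of_nat n"
      using ennreal_Ex_less_of_nat[of "emeasure lborel {a..}"] by (auto simp: top.not_eq_extremum)
    with *[of n] show False by simp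
  qed
qed

text \<open>
  The mechanism behind every contour shift below. The tails of \<open>h\<close> are
  controlled by a bound on \<open>\<integral> |h(x + iy)| dy\<close> uniform in \<open>x\<close>, which is what products of
  Hardy functions offer, and not by pointwise decay. By Tonelli
  the horizontal edges of the rectangles are then absolutely integrable as functions of the height
  \<open>T\<close>, whereas \<open>rect\<close> and the integrability on the two vertical lines make their difference
  converge as \<open>T \<rightarrow> \<infinity>\<close>. An integrable function can only converge to \<open>0\<close>. The point \<open>w\<close>
  is a possible singularity of \<open>h\<close>, and \<open>L\<close> its contribution.
\<close>

lemma vertical_line_integrals_differ:
  fixes h :: "complex \<Rightarrow> complex" and M :: ennreal
  assumes cd: "c < d" and T0: "\<bar>Im w\<bar> < T0" and w: "c < Re w" "Re w < d"
    and cont: "continuous_on ({z. c \<le> Re z \<and> Re z \<le> d} - {w}) h"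
    and rect: "\<And>T. T0 \<le> T \<Longrightarrow> contour_integral (rectpath (Complex c (-T)) (Complex d T)) h = L"
    and M: "M < \<infinity>"
    and bound: "\<And>x. c \<le> x \<Longrightarrow> x \<le> d \<Longrightarrow>
      (\<integral>\<^sup>+ y. ennreal (norm (h (Complex x y))) * indicator {y. T0 \<le> \<bar>y\<bar>} y \<partial>lborel) \<le> M"
    and int_c: "integrable lborel (\<lambda>y. h (Complex c y))"
    and int_d: "integrable lborel (\<lambda>y. h (Complex d y))"
  shows "\<i> * ((LINT y|lborel. h (Complex d y)) - (LINT y|lborel. h (Complex c y))) = L"
proof (rule ccontr)
  define V where "V = \<i> * ((LINT y|lborel. h (Complex d y)) - (LINT y|lborel. h (Complex c y)))"
  define VT where "VT = (\<lambda>T. \<i> * (integral {-T..T} (\<lambda>y. h (Complex d y)) - integral {-T..T} (\<lambda>y. h (Complex c y))))"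
  \<comment> \<open>the size of the horizontal edge at height T\<close>
  define G where "G = (\<lambda>T. \<integral>\<^sup>+ x. ennreal (norm (h (Complex x T))) * indicator {c..d} x \<partial>lborel)"
  assume "\<i> * ((LINT y|lborel. h (Complex d y)) - (LINT y|lborel. h (Complex c y))) \<noteq> L"
  then have "V \<noteq> L" by (simp add: V_def)
  define \<delta> where "\<delta> = norm (L - V)"
  have \<delta>: "\<delta> > 0" using \<open>V \<noteq> L\<close> by (simp add: \<delta>_def)
  \<comment> \<open>the part of the strip beyond height T0, a closed set on which h is continuous, hence jointly measurable\<close>
  define Q where "Q = {c..d} \<times> {y::real. T0 \<le> \<bar>y\<bar>}"
  have "closed {y::real. T0 \<le> \<bar>y\<bar>}" by (intro closed_Collect_le continuous_intros)
  then have Q: "closed Q" unfolding Q_def by (intro closed_Times) auto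
  have contQ: "continuous_on Q (\<lambda>p. norm (h (Complex (fst p) (snd p))))"
    by (intro continuous_on_norm continuous_on_compose2[OF cont])
       (use T0 in \<open>auto simp: Q_def Complex_eq intro!: continuous_intros\<close>)
  have "(\<lambda>p. indicator Q p *\<^sub>R norm (h (Complex (fst p) (snd p)))) \<in> borel_measurable borel"
    using Q contQ by (intro borel_measurable_continuous_on_indicator) auto
  then have "(\<lambda>p. ennreal (indicator Q p *\<^sub>R norm (h (Complex (fst p) (snd p))))) \<in> borel_measurable borel"
    by (intro measurable_compose[OF _ measurable_ennreal])
  moreover have "sets (lborel \<Otimes>\<^sub>M lborel :: (real \<times> real) measure) = sets borel"
    unfolding borel_prod[symmetric] by (intro sets_pair_measure_cong) auto
  ultimately have "(\<lambda>p. ennreal (indicator Q p *\<^sub>R norm (h (Complex (fst p) (snd p))))) \<in> borel_measurable (lborel \<Otimes>\<^sub>M lborel)"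
    by (subst measurable_cong_sets[OF _ refl])
  then have meas: "(\<lambda>(x,y). ennreal (indicator Q (x,y) *\<^sub>R norm (h (Complex x y)))) \<in> borel_measurable (lborel \<Otimes>\<^sub>M lborel)"
    by (simp only: case_prod_unfold prod.collapse)
  have GM: "(\<integral>\<^sup>+ y. G y * indicator {y. T0 \<le> \<bar>y\<bar>} y \<partial>lborel) = (\<integral>\<^sup>+ y. \<integral>\<^sup>+ x. ennreal (indicator Q (x,y) *\<^sub>R norm (h (Complex x y))) \<partial>lborel \<partial>lborel)"
    unfolding G_def
    by (intro nn_integral_cong) (auto simp: Q_def indicator_def intro!: nn_integral_cong)
  have measG: "(\<lambda>y. G y * indicator {y. T0 \<le> \<bar>y\<bar>} y) \<in> borel_measurable borel"
  proof -
    have "(\<lambda>y. \<integral>\<^sup>+ x. ennreal (indicator Q (x,y) *\<^sub>R norm (h (Complex x y))) \<partial>lborel) \<in> borel_measurable lborel"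
      using measurable_pair_swap[OF meas]
      by (intro lborel.borel_measurable_nn_integral) (simp add: case_prod_unfold)
    also have "(\<lambda>y. \<integral>\<^sup>+ x. ennreal (indicator Q (x,y) *\<^sub>R norm (h (Complex x y))) \<partial>lborel) = (\<lambda>y. G y * indicator {y. T0 \<le> \<bar>y\<bar>} y)"
      unfolding G_def by (intro ext) (auto simp: Q_def indicator_def intro!: nn_integral_cong)
    finally show ?thesis by simp
  qed
  have fin: "(\<integral>\<^sup>+ y. G y * indicator {y. T0 \<le> \<bar>y\<bar>} y \<partial>lborel) < \<infinity>"
  proof -
    have "(\<integral>\<^sup>+ y. G y * indicator {y. T0 \<le> \<bar>y\<bar>} y \<partial>lborel) =
      (\<integral>\<^sup>+ x. \<integral>\<^sup>+ y. ennreal (indicator Q (x,y) *\<^sub>R norm (h (Complex x y))) \<partial>lborel \<partial>lborel)"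
      unfolding GM using meas by (rule lborel_pair.Fubini')
    also have "\<dots> \<le> (\<integral>\<^sup>+ x. M * indicator {c..d} x \<partial>lborel)"
    proof (rule nn_integral_mono)
      fix x :: real
      have "(\<integral>\<^sup>+ y. ennreal (indicator Q (x,y) *\<^sub>R norm (h (Complex x y))) \<partial>lborel) =
        (if x \<in> {c..d} then (\<integral>\<^sup>+ y. ennreal (norm (h (Complex x y))) * indicator {y. T0 \<le> \<bar>y\<bar>} y \<partial>lborel) else 0)"
        by (auto simp: Q_def indicator_def intro!: nn_integral_cong)
      also have "\<dots> \<le> M * indicator {c..d} x" using bound by auto
      finally show "(\<integral>\<^sup>+ y. ennreal (indicator Q (x,y) *\<^sub>R norm (h (Complex x y))) \<partial>lborel) \<le> M * indicator {c..d} x" .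
    qed
    also have "\<dots> = M * ennreal (d - c)" using cd by (simp add: nn_integral_cmult_indicator)
    also have "\<dots> < \<infinity>" using M by (simp add: ennreal_mult_less_top)
    finally show ?thesis .
  qed
  have horiz: "ennreal (norm (L - VT T)) \<le> G T + G (-T)" if "T0 \<le> T" for T
  proof -
    have T: "0 < T" using that T0 by linarith
    have sub: "path_image (rectpath (Complex c (-T)) (Complex d T)) \<subseteq> {z. c \<le> Re z \<and> Re z \<le> d} - {w}"
      using cd T T0 w that by (subst path_image_rectpath) auto
    have "L - VT T = integral {c..d} (\<lambda>x. h (Complex x (-T))) - integral {c..d} (\<lambda>x. h (Complex x T))"
      unfolding VT_def rect[OF that, symmetric] rectangle_contour_integral[OF cd T continuous_on_subset[OF cont sub]]
      by simp
    then have "norm (L - VT T) \<le> norm (integral {c..d} (\<lambda>x. h (Complex x T))) + norm (integral {c..d} (\<lambda>x. h (Complex x (-T))))"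
      by (metis add.commute norm_triangle_ineq4)
    then have "ennreal (norm (L - VT T)) \<le> ennreal (norm (integral {c..d} (\<lambda>x. h (Complex x T)))) + ennreal (norm (integral {c..d} (\<lambda>x. h (Complex x (-T)))))"
      by (simp flip: ennreal_plus)
    also have "\<dots> \<le> G T + G (-T)"
      unfolding G_def using T0 that
      by (intro add_mono norm_integral_le_nn_integral continuous_on_compose2[OF cont])
         (auto simp: Complex_eq intro!: continuous_intros)
    finally show ?thesis .
  qed
  have "(VT \<longlongrightarrow> V) at_top"
    unfolding VT_def V_def by (intro tendsto_intros truncated_integral_tendsto int_c int_d)
  then have "((\<lambda>T. norm (L - VT T)) \<longlongrightarrow> \<delta>) at_top"
    unfolding \<delta>_def by (intro tendsto_intros)
  then have "eventually (\<lambda>T. \<delta> / 2 < norm (L - VT T)) at_top"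
    using \<delta> by (intro order_tendstoD) auto
  then obtain T1 where T1: "\<And>T. T1 \<le> T \<Longrightarrow> \<delta> / 2 < norm (L - VT T)"
    by (auto simp: eventually_at_top_linorder)
  define T2 where "T2 = max T0 T1"
  \<comment> \<open>both edges together stay above delta/2 for large T, which contradicts integrability\<close>
  have "\<infinity> = (\<integral>\<^sup>+ T. ennreal (\<delta> / 2) * indicator {T2..} T \<partial>lborel)"
    using \<delta> by (simp add: nn_integral_cmult_indicator ennreal_mult_eq_top_iff emeasure_lborel_atLeast)
  also have "\<dots> \<le> (\<integral>\<^sup>+ T. G T * indicator {y. T0 \<le> \<bar>y\<bar>} T + G (-T) * indicator {y. T0 \<le> \<bar>y\<bar>} (-T) \<partial>lborel)"
  proof (rule nn_integral_mono)
    fix T :: real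
    show "ennreal (\<delta> / 2) * indicator {T2..} T \<le> G T * indicator {y. T0 \<le> \<bar>y\<bar>} T + G (-T) * indicator {y. T0 \<le> \<bar>y\<bar>} (-T)"
    proof (cases "T2 \<le> T")
      case True
      then have "T0 \<le> T" "T1 \<le> T" by (auto simp: T2_def)
      have "ennreal (\<delta> / 2) \<le> ennreal (norm (L - VT T))" using T1[OF \<open>T1 \<le> T\<close>] by (intro ennreal_leI) simp
      also note horiz[OF \<open>T0 \<le> T\<close>]
      finally show ?thesis using True \<open>T0 \<le> T\<close> by (auto simp: indicator_def)
    qed auto
  qed
  also have "\<dots> = (\<integral>\<^sup>+ T. G T * indicator {y. T0 \<le> \<bar>y\<bar>} T \<partial>lborel) + (\<integral>\<^sup>+ T. G (-T) * indicator {y. T0 \<le> \<bar>y\<bar>} (-T) \<partial>lborel)"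
    using measG measurable_compose[OF borel_measurable_uminus[OF measurable_ident] measG]
    by (intro nn_integral_add) auto
  also have "(\<integral>\<^sup>+ T. G (-T) * indicator {y. T0 \<le> \<bar>y\<bar>} (-T) \<partial>lborel) = (\<integral>\<^sup>+ T. G T * indicator {y. T0 \<le> \<bar>y\<bar>} T \<partial>lborel)"
    using nn_integral_real_affine[OF measG, of "-1" 0] by simp
  also have "\<dots> + \<dots> < \<infinity>" using fin by simp
  finally show False by simp
qed

lemma convex_vertical_strip: "convex {z::complex. a < Re z \<and> Re z < b}"
proof -
  have "{z::complex. a < Re z \<and> Re z < b} = {z. a < Re z} \<inter> {z. Re z < b}" by auto
  then show ?thesis by (metis convex_Int convex_halfspace_Re_gt convex_halfspace_Re_lt)
qed

lemma open_vertical_strip: "open {z::complex. a < Re z \<and> Re z < b}"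
  by (intro open_Collect_conj open_Collect_less continuous_intros)

lemma borel_measurable_vertical_line:
  assumes "continuous_on A h" "\<And>y. Complex x y \<in> A"
  shows "(\<lambda>y. h (Complex x y)) \<in> borel_measurable borel"
  by (rule borel_measurable_continuous_onI[OF continuous_vertical_line[OF assms]])

lemma vertical_line_shift:
  fixes h :: "complex \<Rightarrow> complex" and M :: ennreal
  assumes hol: "h holomorphic_on {z. a < Re z \<and> Re z < b}"
    and abcd: "a < c" "c \<le> d" "d < b"
    and M: "M < \<infinity>"
    and bound: "\<And>x. c \<le> x \<Longrightarrow> x \<le> d \<Longrightarrow> (\<integral>\<^sup>+ y. ennreal (norm (h (Complex x y))) \<partial>lborel) \<le> M"
  shows "(LINT y|lborel. h (Complex c y)) = (LINT y|lborel. h (Complex d y))"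
proof (cases "c = d")
  case False
  then have cd: "c < d" using abcd by simp
  have cont: "continuous_on {z. a < Re z \<and> Re z < b} h" by (rule holomorphic_on_imp_continuous_on[OF hol])
  have int: "integrable lborel (\<lambda>y. h (Complex x y))" if "c \<le> x" "x \<le> d" for x
    using borel_measurable_vertical_line[OF cont, of x] bound[OF that] M that abcd
    by (intro integrableI_bounded) (auto intro: le_less_trans)
  have "\<i> * ((LINT y|lborel. h (Complex d y)) - (LINT y|lborel. h (Complex c y))) = 0"
  proof (rule vertical_line_integrals_differ[where w = "of_real ((c + d) / 2)" and ?T0.0 = 1, OF cd _ _ _ _ _ M])
    fix T :: real assume "1 \<le> T"
    then have "path_image (rectpath (Complex c (-T)) (Complex d T)) \<subseteq> {z. a < Re z \<and> Re z < b}"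
      using cd abcd by (subst path_image_rectpath) auto
    from Cauchy_theorem_convex_simple[OF hol convex_vertical_strip _ this]
    show "contour_integral (rectpath (Complex c (-T)) (Complex d T)) h = 0"
      by (intro contour_integral_unique) auto
  next
    fix x assume x: "c \<le> x" "x \<le> d"
    have "(\<integral>\<^sup>+ y. ennreal (norm (h (Complex x y))) * indicator {y. 1 \<le> \<bar>y\<bar>} y \<partial>lborel) \<le> (\<integral>\<^sup>+ y. ennreal (norm (h (Complex x y))) \<partial>lborel)"
      by (intro nn_integral_mono) (auto simp: indicator_def)
    with bound[OF x] show "(\<integral>\<^sup>+ y. ennreal (norm (h (Complex x y))) * indicator {y. 1 \<le> \<bar>y\<bar>} y \<partial>lborel) \<le> M" by simp
  qed (use cd abcd int in \<open>auto intro!: continuous_on_subset[OF cont]\<close>)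
  then show ?thesis by simp
qed simp

text \<open>
  The integral formula of Cauchy for a strip: the pole of \<open>k z / (z - w)\<close> is kept away from the tails by
  cutting at distance one from \<open>w\<close>, where dividing by \<open>z - w\<close> only decreases the absolute value.
\<close>

lemma vertical_line_residue:
  fixes k :: "complex \<Rightarrow> complex" and M :: ennreal
  assumes hol: "k holomorphic_on {z. a < Re z \<and> Re z < b}"
    and abcd: "a < c" "c < Re w" "Re w < d" "d < b"
    and M: "M < \<infinity>"
    and bound: "\<And>x. c \<le> x \<Longrightarrow> x \<le> d \<Longrightarrow> (\<integral>\<^sup>+ y. ennreal (norm (k (Complex x y))) \<partial>lborel) \<le> M"
  shows "(LINT y|lborel. k (Complex d y) / (Complex d y - w)) - (LINT y|lborel. k (Complex c y) / (Complex c y - w))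
     = 2 * of_real pi * k w"
proof -
  define T0 where "T0 = \<bar>Im w\<bar> + 1"
  have cd: "c < d" using abcd by simp
  have cont: "continuous_on {z. a < Re z \<and> Re z < b} k" by (rule holomorphic_on_imp_continuous_on[OF hol])
  have kw: "continuous_on ({z. a < Re z \<and> Re z < b} - {w}) (\<lambda>z. k z / (z - w))"
    by (intro continuous_intros continuous_on_subset[OF cont]) auto
  have int: "integrable lborel (\<lambda>y. k (Complex x y) / (Complex x y - w))" if x: "x = c \<or> x = d" for x
  proof -
    have xw: "Complex x y - w \<noteq> 0" for y using x abcd by (auto simp: complex_eq_iff)
    have m: "(\<lambda>y. k (Complex x y)) \<in> borel_measurable borel" "(\<lambda>y. k (Complex x y) / (Complex x y - w)) \<in> borel_measurable borel"
      using x abcd by (auto intro!: borel_measurable_vertical_line[OF cont] borel_measurable_vertical_line[OF kw])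
    have ik: "integrable lborel (\<lambda>y. k (Complex x y))"
      using m bound[of x] M x abcd
      by (intro integrableI_bounded) (auto intro: le_less_trans)
    show ?thesis
    proof (rule Bochner_Integration.integrable_bound[OF integrable_mult_right[OF ik, of "of_real (1 / \<bar>x - Re w\<bar>)"]])
      show "AE y in lborel. norm (k (Complex x y) / (Complex x y - w)) \<le> norm (of_real (1 / \<bar>x - Re w\<bar>) * k (Complex x y))"
      proof (rule AE_I2)
        fix y
        have "\<bar>x - Re w\<bar> \<le> norm (Complex x y - w)" using abs_Re_le_cmod[of "Complex x y - w"] by simp
        moreover have "0 < \<bar>x - Re w\<bar>" using x abcd by auto
        ultimately show "norm (k (Complex x y) / (Complex x y - w)) \<le> norm (of_real (1 / \<bar>x - Re w\<bar>) * k (Complex x y))"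
          by (simp add: norm_mult norm_divide) (intro divide_left_mono mult_pos_pos; auto simp: complex_eq_iff)
      qed
    qed (use m in simp)
  qed
  have "\<i> * ((LINT y|lborel. k (Complex d y) / (Complex d y - w)) - (LINT y|lborel. k (Complex c y) / (Complex c y - w)))
     = of_real (2 * pi) * \<i> * 1 * k w"
  proof (rule vertical_line_integrals_differ[where w = w and ?T0.0 = T0 and h = "\<lambda>z. k z / (z - w)", OF cd _ abcd(2,3) _ _ M])
    fix T :: real assume T: "T0 \<le> T"
    let ?p = "rectpath (Complex c (-T)) (Complex d T)"
    have sub: "path_image ?p \<subseteq> {z. a < Re z \<and> Re z < b} - {w}"
      using cd abcd T by (subst path_image_rectpath) (auto simp: T0_def)
    have "winding_number ?p w = 1"
      using cd abcd T by (intro winding_number_rectpath) (auto simp: T0_def in_box_complex_iff)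
    moreover have "((\<lambda>z. k z / (z - w)) has_contour_integral (of_real (2 * pi) * \<i> * winding_number ?p w * k w)) ?p"
      using sub abcd by (intro Cauchy_integral_formula_convex_simple[OF convex_vertical_strip hol])
        (auto simp: interior_open[OF open_vertical_strip])
    ultimately show "contour_integral ?p (\<lambda>z. k z / (z - w)) = of_real (2 * pi) * \<i> * 1 * k w"
      by (intro contour_integral_unique) simp
  next
    fix x assume x: "c \<le> x" "x \<le> d"
    have "(\<integral>\<^sup>+ y. ennreal (norm (k (Complex x y) / (Complex x y - w))) * indicator {y. T0 \<le> \<bar>y\<bar>} y \<partial>lborel) \<le> (\<integral>\<^sup>+ y. ennreal (norm (k (Complex x y))) \<partial>lborel)"
    proof (rule nn_integral_mono)
      fix y
      have "1 \<le> norm (Complex x y - w)" if "T0 \<le> \<bar>y\<bar>"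
        using abs_Im_le_cmod[of "Complex x y - w"] that by (auto simp: T0_def)
      then show "ennreal (norm (k (Complex x y) / (Complex x y - w))) * indicator {y. T0 \<le> \<bar>y\<bar>} y \<le> ennreal (norm (k (Complex x y)))"
        by (auto simp: indicator_def norm_divide divide_le_eq intro!: ennreal_leI mult_left_mono[of 1 _ "norm _", simplified])
    qed
    with bound[OF x] show "(\<integral>\<^sup>+ y. ennreal (norm (k (Complex x y) / (Complex x y - w))) * indicator {y. T0 \<le> \<bar>y\<bar>} y \<partial>lborel) \<le> M" by simp
  qed (use cd abcd int in \<open>auto simp: T0_def intro!: continuous_on_subset[OF kw]\<close>)
  then have "\<i> * ((LINT y|lborel. k (Complex d y) / (Complex d y - w)) - (LINT y|lborel. k (Complex c y) / (Complex c y - w)))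
     = \<i> * (2 * of_real pi * k w)" by simp
  then show ?thesis unfolding mult_cancel_left by simp
qed

section \<open>Square-integrable functions on a line\<close>

text \<open>
  The squared \<open>L\<^sup>2\<close> norm, with value \<open>\<infinity>\<close> outside \<open>L\<^sup>2\<close>; this makes the suprema, limits
  and sums occurring in the definitions of the function spaces directly expressible.
\<close>

definition sq_norm :: "(real \<Rightarrow> complex) \<Rightarrow> ennreal" where
  "sq_norm u = (\<integral>\<^sup>+ y. ennreal ((norm (u y))\<^sup>2) \<partial>lborel)"

lemma sq_norm_add_le:
  assumes [measurable]: "u \<in> borel_measurable borel" "v \<in> borel_measurable borel"
  shows "sq_norm (\<lambda>y. u y + v y) \<le> 2 * sq_norm u + 2 * sq_norm v"
proof -
  have "sq_norm (\<lambda>y. u y + v y) \<le> (\<integral>\<^sup>+ y. 2 * ennreal ((norm (u y))\<^sup>2) + 2 * ennreal ((norm (v y))\<^sup>2) \<partial>lborel)"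
    unfolding sq_norm_def
  proof (rule nn_integral_mono)
    fix y
    have "(norm (u y + v y))\<^sup>2 \<le> (norm (u y) + norm (v y))\<^sup>2"
      by (intro power_mono norm_triangle_ineq) auto
    also have "\<dots> \<le> 2 * (norm (u y))\<^sup>2 + 2 * (norm (v y))\<^sup>2"
      using sum_squares_bound[of "norm (u y)" "norm (v y)"] by (simp add: power2_sum)
    finally have "ennreal ((norm (u y + v y))\<^sup>2) \<le> ennreal (2 * (norm (u y))\<^sup>2 + 2 * (norm (v y))\<^sup>2)"
      by (rule ennreal_leI)
    then show "ennreal ((norm (u y + v y))\<^sup>2) \<le> 2 * ennreal ((norm (u y))\<^sup>2) + 2 * ennreal ((norm (v y))\<^sup>2)"
      by (simp add: ennreal_plus ennreal_mult)
  qed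
  also have "\<dots> = 2 * sq_norm u + 2 * sq_norm v"
    unfolding sq_norm_def by (subst nn_integral_add) (simp_all add: nn_integral_cmult)
  finally show ?thesis .
qed

lemma nn_integral_mult_le_sq_norm:
  assumes [measurable]: "u \<in> borel_measurable borel" "v \<in> borel_measurable borel"
  shows "(\<integral>\<^sup>+ y. ennreal (norm (u y * v y)) \<partial>lborel) \<le> sq_norm u + sq_norm v"
proof -
  have "(\<integral>\<^sup>+ y. ennreal (norm (u y * v y)) \<partial>lborel) \<le> (\<integral>\<^sup>+ y. ennreal ((norm (u y))\<^sup>2) + ennreal ((norm (v y))\<^sup>2) \<partial>lborel)"
  proof (rule nn_integral_mono)
    fix y
    have "2 * (norm (u y) * norm (v y)) \<le> (norm (u y))\<^sup>2 + (norm (v y))\<^sup>2"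
      using sum_squares_bound[of "norm (u y)" "norm (v y)"] by simp
    moreover have "0 \<le> norm (u y) * norm (v y)" by simp
    ultimately have "norm (u y) * norm (v y) \<le> (norm (u y))\<^sup>2 + (norm (v y))\<^sup>2" by linarith
    then show "ennreal (norm (u y * v y)) \<le> ennreal ((norm (u y))\<^sup>2) + ennreal ((norm (v y))\<^sup>2)"
      by (simp add: norm_mult ennreal_leI flip: ennreal_plus)
  qed
  also have "\<dots> = sq_norm u + sq_norm v"
    unfolding sq_norm_def by (subst nn_integral_add) simp_all
  finally show ?thesis .
qed

lemma integrable_mult_sq_norm:
  assumes [measurable]: "u \<in> borel_measurable borel" "v \<in> borel_measurable borel"
    and "sq_norm u < \<infinity>" "sq_norm v < \<infinity>"
  shows "integrable lborel (\<lambda>y. u y * v y)"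
proof (rule integrableI_bounded)
  have "sq_norm u + sq_norm v < \<infinity>" using assms by simp
  then show "(\<integral>\<^sup>+ y. ennreal (norm (u y * v y)) \<partial>lborel) < \<infinity>"
    using nn_integral_mult_le_sq_norm[OF assms(1,2)] by (rule le_less_trans[rotated])
qed simp

lemma borel_measurable_cnj [measurable]:
  assumes "u \<in> borel_measurable M"
  shows "(\<lambda>y. cnj (u y)) \<in> borel_measurable M"
  by (rule borel_measurable_continuous_on[OF _ assms]) (intro continuous_intros)

lemma sq_norm_cnj [simp]: "sq_norm (\<lambda>y. cnj (u y)) = sq_norm u"
  by (simp add: sq_norm_def)

lemma norm_inner_le_sq_norm:
  assumes [measurable]: "u \<in> borel_measurable borel" "v \<in> borel_measurable borel"
    and "sq_norm u < \<infinity>" "sq_norm v < \<infinity>"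
  shows "ennreal ((norm (LINT y|lborel. u y * v y))\<^sup>2) \<le> sq_norm u * sq_norm v"
proof -
  have "ennreal (norm (LINT y|lborel. u y * v y)) \<le> (\<integral>\<^sup>+ y. ennreal (norm (u y)) * ennreal (norm (v y)) \<partial>lborel)"
    using integral_norm_bound_ennreal[OF integrable_mult_sq_norm[OF assms]] by (simp add: norm_mult ennreal_mult)
  then have "ennreal ((norm (LINT y|lborel. u y * v y))\<^sup>2) \<le> (\<integral>\<^sup>+ y. ennreal (norm (u y)) * ennreal (norm (v y)) \<partial>lborel)\<^sup>2"
    by (simp add: power_mono flip: ennreal_power)
  also have "\<dots> \<le> sq_norm u * sq_norm v"
    unfolding sq_norm_def by (rule Cauchy_Schwarz_nn_integral[THEN order_trans]) (simp_all add: ennreal_power)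
  finally show ?thesis .
qed

text \<open>
  Expanding \<open>|u - v|\<^sup>2\<close> reduces the convergence of a family in \<open>L\<^sup>2\<close> to that of its inner products.
  The case \<open>v = 0\<close> expresses the norm itself as an inner product.
\<close>

lemma sq_norm_diff_eq:
  assumes [measurable]: "u \<in> borel_measurable borel" "v \<in> borel_measurable borel"
    and fin: "sq_norm u < \<infinity>" "sq_norm v < \<infinity>"
  shows "sq_norm (\<lambda>y. u y - v y) = ennreal (Re (LINT y|lborel. u y * cnj (u y)) + Re (LINT y|lborel. v y * cnj (v y))
     - 2 * Re (LINT y|lborel. u y * cnj (v y)))"
    and "0 \<le> Re (LINT y|lborel. u y * cnj (u y)) + Re (LINT y|lborel. v y * cnj (v y))
     - 2 * Re (LINT y|lborel. u y * cnj (v y))"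
proof -
  have [simp]: "integrable lborel (\<lambda>y. u y * cnj (u y))" "integrable lborel (\<lambda>y. v y * cnj (v y))"
      "integrable lborel (\<lambda>y. u y * cnj (v y))"
    using fin by (intro integrable_mult_sq_norm; simp)+
  have gen: "(LINT y|lborel. Re (p y) + Re (q y) - 2 * Re (r y)) = Re (LINT y|lborel. p y) + Re (LINT y|lborel. q y) - 2 * Re (LINT y|lborel. r y)"
    if "integrable lborel p" "integrable lborel q" "integrable lborel r" for p q r :: "real \<Rightarrow> complex"
    using that by simp
  have pt: "(norm (u y - v y))\<^sup>2 = Re (u y * cnj (u y)) + Re (v y * cnj (v y)) - 2 * Re (u y * cnj (v y))" for y
    unfolding cmod_power2 by (simp add: power2_eq_square algebra_simps)
  have int: "integrable lborel (\<lambda>y. Re (u y * cnj (u y)) + Re (v y * cnj (v y)) - 2 * Re (u y * cnj (v y)))"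
    by (intro Bochner_Integration.integrable_diff Bochner_Integration.integrable_add integrable_mult_right integrable_Re) auto
  have eq: "(LINT y|lborel. (norm (u y - v y))\<^sup>2) = Re (LINT y|lborel. u y * cnj (u y)) + Re (LINT y|lborel. v y * cnj (v y))
     - 2 * Re (LINT y|lborel. u y * cnj (v y))"
    unfolding pt by (rule gen) simp_all
  show "sq_norm (\<lambda>y. u y - v y) = ennreal (Re (LINT y|lborel. u y * cnj (u y)) + Re (LINT y|lborel. v y * cnj (v y))
     - 2 * Re (LINT y|lborel. u y * cnj (v y)))"
    unfolding sq_norm_def eq[symmetric] using int unfolding pt[symmetric] by (intro nn_integral_eq_integral) auto
  show "0 \<le> Re (LINT y|lborel. u y * cnj (u y)) + Re (LINT y|lborel. v y * cnj (v y))
     - 2 * Re (LINT y|lborel. u y * cnj (v y))"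
    unfolding eq[symmetric] by simp
qed

lemma ennreal_tendsto_0I:
  fixes \<phi> :: "'a \<Rightarrow> ennreal"
  assumes "\<And>m::nat. eventually (\<lambda>x. \<phi> x \<le> ennreal ((1/4)^m)) F"
  shows "(\<phi> \<longlongrightarrow> 0) F"
proof (rule order_tendstoI)
  fix a :: ennreal assume "0 < a"
  have "(\<lambda>m. ennreal ((1/4)^m)) \<longlonglongrightarrow> ennreal 0"
    by (intro tendsto_ennrealI LIMSEQ_realpow_zero) auto
  then have "eventually (\<lambda>m. ennreal ((1/4)^m) < a) sequentially"
    using \<open>0 < a\<close> by (intro order_tendstoD) auto
  then obtain m where "ennreal ((1/4)^m) < a" by (auto simp: eventually_sequentially)
  with assms[of m] show "eventually (\<lambda>x. \<phi> x < a) F"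
    by (auto elim: eventually_mono)
qed auto

text \<open>
  The weights \<open>2 ^ k\<close> leave room for a geometric series: the increments are \<open>O(2 powr (- k / 2))\<close>.
\<close>

lemma square_summable_imp_convergent:
  fixes a :: "nat \<Rightarrow> complex"
  assumes "(\<Sum>k. ennreal (2^k * (norm (a (Suc k) - a k))\<^sup>2)) < \<infinity>"
  shows "convergent a"
proof -
  define F where "F = (\<lambda>k. ennreal (2^k * (norm (a (Suc k) - a k))\<^sup>2))"
  define C where "C = enn2real (suminf F)"
  have fin: "suminf F < \<infinity>" using assms by (simp only: F_def)
  have C: "2^k * (norm (a (Suc k) - a k))\<^sup>2 \<le> C" for k
  proof -
    have "F k \<le> suminf F"
      using sum_le_suminf[OF summableI, of "{k}" F] by simp
    then have "enn2real (F k) \<le> C"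
      unfolding C_def by (rule enn2real_mono) (use fin in simp)
    then show ?thesis by (simp only: F_def) (subst (asm) enn2real_ennreal; simp)
  qed
  have b: "norm (a (Suc k) - a k) \<le> sqrt C * (1 / sqrt 2)^k" for k
  proof -
    have "(norm (a (Suc k) - a k))\<^sup>2 \<le> C / 2^k" using C[of k] by (simp add: field_simps)
    then have "norm (a (Suc k) - a k) \<le> sqrt (C / 2^k)" by (rule real_le_rsqrt)
    then show ?thesis by (simp add: real_sqrt_divide real_sqrt_power power_divide)
  qed
  have "summable (\<lambda>k. sqrt C * (1 / sqrt 2)^k)"
    by (intro summable_mult summable_geometric) auto
  then have "summable (\<lambda>k. a (Suc k) - a k)"
    by (rule summable_comparison_test'[where N = 0]) (use b in auto)
  then have "convergent (\<lambda>n. (\<Sum>k<n. a (Suc k) - a k))" by (simp add: summable_iff_convergent)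
  then have "convergent (\<lambda>n. (\<Sum>k<n. a (Suc k) - a k) + a 0)" by (intro convergent_add convergent_const)
  then show ?thesis by (simp add: sum_lessThan_telescope)
qed

text \<open>
  Completeness of \<open>L\<^sup>2\<close> for a family indexed by a real parameter tending to \<open>0\<close>: along a
  sequence \<open>X\<close> with fast decreasing distances the functions converge almost everywhere, and the Fatou lemma
  transfers the Cauchy estimates to the pointwise limit.
\<close>

lemma L2_Cauchy_imp_limit:
  fixes u :: "real \<Rightarrow> real \<Rightarrow> complex"
  assumes b: "0 < b"
    and meas: "\<And>x. 0 < x \<Longrightarrow> x < b \<Longrightarrow> u x \<in> borel_measurable borel"
    and fin: "\<And>x. 0 < x \<Longrightarrow> x < b \<Longrightarrow> sq_norm (u x) < \<infinity>"
    and Cauchy: "\<And>e. 0 < e \<Longrightarrow> \<exists>\<eta>>0. \<forall>x x'. 0 < x \<and> x < \<eta> \<and> 0 < x' \<and> x' < \<eta> \<longrightarrow> sq_norm (\<lambda>y. u x y - u x' y) \<le> ennreal e"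
  shows "\<exists>g \<in> L2 lborel. ((\<lambda>x. sq_norm (\<lambda>y. u x y - g y)) \<longlongrightarrow> 0) (at_right 0)"
proof -
  have "\<forall>k. \<exists>\<eta>>0. \<forall>x x'. 0 < x \<and> x < \<eta> \<and> 0 < x' \<and> x' < \<eta> \<longrightarrow> sq_norm (\<lambda>y. u x y - u x' y) \<le> ennreal ((1/4)^k)"
    using Cauchy by simp
  then obtain \<eta> where \<eta>: "\<And>k::nat. \<eta> k > 0"
    "\<And>k x x'. 0 < x \<Longrightarrow> x < \<eta> k \<Longrightarrow> 0 < x' \<Longrightarrow> x' < \<eta> k \<Longrightarrow> sq_norm (\<lambda>y. u x y - u x' y) \<le> ennreal ((1/4)^k)"
    by metis
  define X where "X = (\<lambda>k. min b (Min (\<eta> ` {..k})) / 2)"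
  have X0: "0 < X k" for k using \<eta>(1) b by (auto simp: X_def)
  have Xb: "X k < b" for k
    using b min.cobounded1[of b "Min (\<eta> ` {..k})"] unfolding X_def by linarith
  have X\<eta>: "X j < \<eta> k" if "k \<le> j" for j k
  proof -
    have "Min (\<eta> ` {..j}) \<le> \<eta> k" using that by (intro Min_le) auto
    then show ?thesis using \<eta>(1)[of k] X0[of j] unfolding X_def by linarith
  qed
  have [measurable]: "u (X k) \<in> borel_measurable borel" for k using X0 Xb by (intro meas)
  define g where "g = (\<lambda>y. lim (\<lambda>k. u (X k) y))"
  have g_meas [measurable]: "g \<in> borel_measurable borel" unfolding g_def by measurable
  have "(\<integral>\<^sup>+ y. (\<Sum>k. ennreal (2^k * (norm (u (X (Suc k)) y - u (X k) y))\<^sup>2)) \<partial>lborel) =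
      (\<Sum>k. \<integral>\<^sup>+ y. ennreal (2^k * (norm (u (X (Suc k)) y - u (X k) y))\<^sup>2) \<partial>lborel)"
    by (intro nn_integral_suminf) measurable
  also have "\<dots> = (\<Sum>k. ennreal (2^k) * sq_norm (\<lambda>y. u (X (Suc k)) y - u (X k) y))"
    unfolding sq_norm_def by (simp add: ennreal_mult nn_integral_cmult)
  also have "\<dots> \<le> (\<Sum>k. ennreal (2^k) * ennreal ((1/4)^k))"
    by (intro suminf_le mult_left_mono \<eta> X0 X\<eta>) auto
  also have "\<dots> = (\<Sum>k. ennreal ((1/2)^k))"
    by (simp flip: ennreal_mult power_mult_distrib)
  also have "\<dots> = ennreal (\<Sum>k. (1/2)^k)"
    by (intro suminf_ennreal2 summable_geometric) auto
  also have "\<dots> < \<infinity>" by simp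
  finally have "(\<integral>\<^sup>+ y. (\<Sum>k. ennreal (2^k * (norm (u (X (Suc k)) y - u (X k) y))\<^sup>2)) \<partial>lborel) \<noteq> \<infinity>" by simp
  then have "AE y in lborel. (\<Sum>k. ennreal (2^k * (norm (u (X (Suc k)) y - u (X k) y))\<^sup>2)) \<noteq> \<infinity>"
    by (intro nn_integral_PInf_AE) measurable
  then have AE: "AE y in lborel. (\<lambda>k. u (X k) y) \<longlonglongrightarrow> g y"
    unfolding g_def
    by eventually_elim (auto intro!: square_summable_imp_convergent simp: top.not_eq_extremum simp flip: convergent_LIMSEQ_iff)
  have close: "sq_norm (\<lambda>y. u x y - g y) \<le> ennreal ((1/4)^m)" if "0 < x" "x < b" "x < \<eta> m" for x m
  proof -
    have [measurable]: "u x \<in> borel_measurable borel" using that by (intro meas)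
    have "sq_norm (\<lambda>y. u x y - g y) = (\<integral>\<^sup>+ y. liminf (\<lambda>k. ennreal ((norm (u x y - u (X k) y))\<^sup>2)) \<partial>lborel)"
      unfolding sq_norm_def
    proof (rule nn_integral_cong_AE)
      show "AE y in lborel. ennreal ((norm (u x y - g y))\<^sup>2) = liminf (\<lambda>k. ennreal ((norm (u x y - u (X k) y))\<^sup>2))"
        using AE
      proof eventually_elim
        case (elim y)
        then have "(\<lambda>k. ennreal ((norm (u x y - u (X k) y))\<^sup>2)) \<longlonglongrightarrow> ennreal ((norm (u x y - g y))\<^sup>2)"
          by (intro tendsto_ennrealI tendsto_intros)
        then show ?case by (intro lim_imp_Liminf[symmetric]) auto
      qed
    qed
    also have "\<dots> \<le> liminf (\<lambda>k. sq_norm (\<lambda>y. u x y - u (X k) y))"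
      unfolding sq_norm_def by (rule nn_integral_liminf) measurable
    also have "\<dots> \<le> liminf (\<lambda>k. ennreal ((1/4)^m))"
    proof (rule Liminf_mono)
      show "eventually (\<lambda>k. sq_norm (\<lambda>y. u x y - u (X k) y) \<le> ennreal ((1/4)^m)) sequentially"
        using eventually_ge_at_top[of m]
        by eventually_elim (use that X0 X\<eta> in \<open>auto intro!: \<eta>(2)\<close>)
    qed
    also have "\<dots> = ennreal ((1/4)^m)" by (simp add: Liminf_const)
    finally show ?thesis .
  qed
  have "sq_norm g < \<infinity>"
  proof -
    have 1: "sq_norm (\<lambda>y. g y - u (X 0) y) < \<infinity>"
      using close[of "X 0" 0] X0 Xb X\<eta>[of 0 0] by (simp add: sq_norm_def norm_minus_commute le_less_trans)
    have "sq_norm g \<le> 2 * sq_norm (\<lambda>y. g y - u (X 0) y) + 2 * sq_norm (u (X 0))"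
      using sq_norm_add_le[of "\<lambda>y. g y - u (X 0) y" "u (X 0)"] by simp
    also have "\<dots> < \<infinity>" using 1 fin[OF X0 Xb] by (simp add: ennreal_mult_less_top)
    finally show ?thesis .
  qed
  then have "g \<in> L2 lborel" by (simp add: L2_def sq_norm_def)
  moreover have "((\<lambda>x. sq_norm (\<lambda>y. u x y - g y)) \<longlongrightarrow> 0) (at_right 0)"
  proof (rule ennreal_tendsto_0I)
    fix m
    show "eventually (\<lambda>x. sq_norm (\<lambda>y. u x y - g y) \<le> ennreal ((1/4)^m)) (at_right 0)"
      unfolding eventually_at_right_field using \<eta>(1)[of m] b close
      by (intro exI[of _ "min b (\<eta> m)"]) auto
  qed
  ultimately show ?thesis by blast
qed

section \<open>Boundary values of Hardy functions on a strip\<close>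

text \<open>
  Along an arithmetic progression the increments of a midpoint convex function do not decrease. If
  the first of them were large, \<open>n\<close> of them would lift \<open>E\<close> above its bound \<open>B\<close>.
\<close>

lemma midpoint_convex_increment_le:
  fixes E :: "real \<Rightarrow> real"
  assumes convex: "\<And>x y. 0 < x \<Longrightarrow> x < b \<Longrightarrow> 0 < y \<Longrightarrow> y < b \<Longrightarrow> 2 * E ((x + y) / 2) \<le> E x + E y"
    and bounded: "\<And>x. 0 < x \<Longrightarrow> x < b \<Longrightarrow> 0 \<le> E x \<and> E x \<le> B"
    and s: "0 < s" "s \<le> t" "t * real n < b" "0 < n"
  shows "E t - E s \<le> B / real n"
proof -
  define a where "a = (\<lambda>k::nat. E (s + real k * (t - s)))"
  have dom: "0 < s + real k * (t - s) \<and> s + real k * (t - s) < b" if "k \<le> n" for k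
  proof -
    have "real k * (t - s) \<le> real n * (t - s)" using that s by (intro mult_right_mono) auto
    moreover have "s \<le> real n * s" using s by simp
    moreover have "real n * (t - s) = t * real n - real n * s" by (simp add: algebra_simps)
    ultimately have "s + real k * (t - s) < b" using s by linarith
    moreover have "0 \<le> real k * (t - s)" using s by simp
    ultimately show ?thesis using s by linarith
  qed
  have step: "a 1 - a 0 \<le> a (Suc k) - a k" if "Suc k \<le> n" for k
    using that
  proof (induction k)
    case (Suc k)
    have "2 * E (((s + real k * (t - s)) + (s + real (Suc (Suc k)) * (t - s))) / 2) \<le> a k + a (Suc (Suc k))"
      unfolding a_def using dom[of k] dom[of "Suc (Suc k)"] Suc.prems by (intro convex) auto
    also have "((s + real k * (t - s)) + (s + real (Suc (Suc k)) * (t - s))) / 2 = s + real (Suc k) * (t - s)"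
      by (simp add: field_simps)
    finally have "a (Suc k) - a k \<le> a (Suc (Suc k)) - a (Suc k)" by (simp add: a_def)
    with Suc show ?case by simp
  qed simp
  have "real m * (a 1 - a 0) \<le> a m - a 0" if "m \<le> n" for m
    using that
  proof (induction m)
    case (Suc m)
    then show ?case using step[of m] by (simp add: algebra_simps)
  qed simp
  then have "real n * (a 1 - a 0) \<le> a n - a 0" by simp
  also have "\<dots> \<le> B"
    using bounded[of "s + real n * (t - s)"] bounded[of "s + real 0 * (t - s)"] dom[of n] dom[of 0]
    by (simp add: a_def)
  finally show ?thesis using s by (simp add: a_def field_simps)
qed

text \<open>
  The limit is the limit superior \<open>L\<close> at \<open>0\<close>. A point \<open>t\<close> where \<open>E\<close> is close to \<open>L\<close>
  forces \<open>E\<close> to be almost as large on all of \<open>(0, t]\<close>, because near \<open>0\<close> the function \<open>E\<close>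
  cannot increase noticeably.
\<close>

lemma midpoint_convex_bounded_tendsto:
  fixes E :: "real \<Rightarrow> real"
  assumes b: "0 < b"
    and convex: "\<And>x y. 0 < x \<Longrightarrow> x < b \<Longrightarrow> 0 < y \<Longrightarrow> y < b \<Longrightarrow> 2 * E ((x + y) / 2) \<le> E x + E y"
    and bounded: "\<And>x. 0 < x \<Longrightarrow> x < b \<Longrightarrow> 0 \<le> E x \<and> E x \<le> B"
  shows "\<exists>L. \<forall>e>0. \<exists>\<eta>>0. \<eta> \<le> b \<and> (\<forall>x. 0 < x \<and> x < \<eta> \<longrightarrow> \<bar>E x - L\<bar> \<le> e)"
proof -
  define S where "S = (\<lambda>\<eta>. SUP x\<in>{0<..<\<eta>}. E x)"
  define L where "L = (INF \<eta>\<in>{0<..b}. S \<eta>)"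
  have bdd: "bdd_above (E ` {0<..<\<eta>})" if "\<eta> \<le> b" for \<eta>
    using bounded that by (intro bdd_aboveI[of _ B]) auto
  have S0: "0 \<le> S \<eta>" if "0 < \<eta>" "\<eta> \<le> b" for \<eta>
  proof -
    have "E (\<eta> / 2) \<le> S \<eta>" unfolding S_def using that by (intro cSUP_upper bdd) auto
    then show ?thesis using bounded[of "\<eta> / 2"] that by simp
  qed
  have bddS: "bdd_below (S ` {0<..b})" using S0 by (auto intro!: bdd_belowI[of _ 0])
  have LS: "L \<le> S \<eta>" if "0 < \<eta>" "\<eta> \<le> b" for \<eta>
    unfolding L_def using that by (intro cINF_lower bddS) auto
  have "\<exists>\<eta>>0. \<eta> \<le> b \<and> (\<forall>x. 0 < x \<and> x < \<eta> \<longrightarrow> \<bar>E x - L\<bar> \<le> e)" if "0 < e" for e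
  proof -
    have "\<exists>\<eta>\<in>{0<..b}. S \<eta> < L + e"
      using cINF_less_iff[of "{0<..b}" S "L + e", OF _ bddS] b that unfolding L_def by auto
    then obtain \<eta>0 where \<eta>0: "0 < \<eta>0" "\<eta>0 \<le> b" "S \<eta>0 < L + e" by auto
    have up: "E x \<le> L + e" if "0 < x" "x < \<eta>0" for x
    proof -
      have "E x \<le> S \<eta>0" unfolding S_def using that \<eta>0 by (intro cSUP_upper bdd) auto
      then show ?thesis using \<eta>0 by simp
    qed
    obtain n where n: "B / (e/2) < real n" "0 < n"
      by (metis reals_Archimedean2 gr0I of_nat_0 less_trans of_nat_less_iff zero_less_Suc lessI)
    have Bn: "B / real n \<le> e / 2" using n that by (simp add: field_simps)
    have "L - e / 2 < S (b / real n)"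
      using LS[of "b / real n"] b n that by (auto simp: field_simps intro: less_le_trans[of _ L])
    then obtain t where t: "0 < t" "t < b / real n" "L - e / 2 < E t"
      unfolding S_def using b n by (subst (asm) less_cSUP_iff) (auto intro!: bdd simp: field_simps)
    have low: "L - e \<le> E x" if "0 < x" "x \<le> t" for x
    proof -
      have "E t - E x \<le> B / real n"
        using t n that by (intro midpoint_convex_increment_le[OF convex bounded]) (auto simp: field_simps)
      then show ?thesis using t Bn by linarith
    qed
    show ?thesis
      using up low t \<eta>0 by (intro exI[of _ "min t \<eta>0"]) (auto simp: abs_le_iff; smt (verit))
  qed
  then show ?thesis by blast
qed

lemma hardy2_strip_bound:
  assumes "f \<in> hardy2_strip b"
  obtains M where "M < \<infinity>" "\<And>x. 0 < x \<Longrightarrow> x < b \<Longrightarrow> sq_norm (\<lambda>y. f (Complex x y)) \<le> M"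
proof (rule that)
  show "(SUP x\<in>{0<..<b}. sq_norm (\<lambda>y. f (Complex x y))) < \<infinity>"
    using assms by (simp add: hardy2_strip_def sq_norm_def)
qed (auto intro: SUP_upper)

lemma hardy2_strip_sq_norm_finite:
  assumes "f \<in> hardy2_strip b" "0 < x" "x < b"
  shows "sq_norm (\<lambda>y. f (Complex x y)) < \<infinity>"
  using hardy2_strip_bound[OF assms(1)] assms(2,3) by (metis le_less_trans)

lemma hardy2_strip_holomorphic: "f \<in> hardy2_strip b \<Longrightarrow> f holomorphic_on {z. 0 < Re z \<and> Re z < b}"
  by (simp add: hardy2_strip_def strip_def)

lemma hardy2_strip_measurable:
  assumes "f \<in> hardy2_strip b" "0 < x" "x < b"
  shows "(\<lambda>y. f (Complex x y)) \<in> borel_measurable borel"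
  using assms
  by (intro borel_measurable_vertical_line[OF holomorphic_on_imp_continuous_on[OF hardy2_strip_holomorphic]]) auto

text \<open>
  The inner product of two vertical traces depends only on the sum of the abscissas. With
  \<open>s = x + x'\<close> one has \<open>cnj (f (x' + iy)) = cnj (f (cnj (s - z)))\<close> at \<open>z = x + iy\<close>, so the integrand is
  the restriction of a function holomorphic in \<open>z\<close>, whose integral over a vertical line may be shifted.
\<close>

lemma hardy2_strip_inner_shift:
  assumes f: "f \<in> hardy2_strip b"
    and x: "0 < x" "x < b" "0 < x'" "x' < b" "0 < u" "u < b" "0 < u'" "u' < b" and sum: "x + x' = u + u'"
  shows "(LINT y|lborel. f (Complex x y) * cnj (f (Complex x' y))) = (LINT y|lborel. f (Complex u y) * cnj (f (Complex u' y)))"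
proof -
  have le: "(LINT y|lborel. f (Complex x y) * cnj (f (Complex x' y))) = (LINT y|lborel. f (Complex u y) * cnj (f (Complex u' y)))"
    if x: "0 < x" "x < b" "0 < x'" "x' < b" "0 < u" "u < b" "0 < u'" "u' < b" and sum: "x + x' = u + u'" and xu: "x \<le> u"
    for x x' u u'
  proof -
    define s where "s = x + x'"
    define h where "h = (\<lambda>z. f z * (cnj \<circ> f \<circ> cnj) (of_real s - z))"
    have h_eq: "h (Complex t y) = f (Complex t y) * cnj (f (Complex (s - t) y))" for t y
    proof -
      have "cnj (of_real s - Complex t y) = Complex (s - t) y" by (simp add: complex_eq_iff)
      then show ?thesis by (simp add: h_def)
    qed
    obtain M where M: "M < \<infinity>" "\<And>x. 0 < x \<Longrightarrow> x < b \<Longrightarrow> sq_norm (\<lambda>y. f (Complex x y)) \<le> M"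
      using hardy2_strip_bound[OF f] by blast
    have cnj_strip: "cnj ` {z. 0 < Re z \<and> Re z < b} = {z. 0 < Re z \<and> Re z < b}"
    proof -
      have "z \<in> cnj ` {z. 0 < Re z \<and> Re z < b}" if "0 < Re z" "Re z < b" for z
        using that by (intro image_eqI[of _ _ "cnj z"]) auto
      then show ?thesis by auto
    qed
    have "(cnj \<circ> f \<circ> cnj) holomorphic_on {z. 0 < Re z \<and> Re z < b}"
      using hardy2_strip_holomorphic[OF f] by (intro holomorphic_on_compose_cnj_cnj) (simp_all add: cnj_strip open_vertical_strip)
    then have "((cnj \<circ> f \<circ> cnj) \<circ> (\<lambda>z. of_real s - z)) holomorphic_on {z. max 0 (s - b) < Re z \<and> Re z < min b s}"
      by (rule holomorphic_on_compose_gen[rotated]) (auto intro!: holomorphic_intros)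
    then have hol: "h holomorphic_on {z. max 0 (s - b) < Re z \<and> Re z < min b s}"
      unfolding h_def
      by (intro holomorphic_on_mult holomorphic_on_subset[OF hardy2_strip_holomorphic[OF f]]) (auto simp: o_def)
    have "(LINT y|lborel. h (Complex x y)) = (LINT y|lborel. h (Complex u y))"
    proof (rule vertical_line_shift[OF hol])
      show "M + M < \<infinity>" using M by simp
      fix t assume t: "x \<le> t" "t \<le> u"
      have t': "0 < t" "t < b" "0 < s - t" "s - t < b" using t x sum by (auto simp: s_def)
      have "(\<integral>\<^sup>+ y. ennreal (norm (h (Complex t y))) \<partial>lborel) \<le> sq_norm (\<lambda>y. f (Complex t y)) + sq_norm (\<lambda>y. cnj (f (Complex (s - t) y)))"
        unfolding h_eq using t' by (intro nn_integral_mult_le_sq_norm borel_measurable_cnj hardy2_strip_measurable[OF f])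
      also have "\<dots> \<le> M + M" using t' M by (intro add_mono) auto
      finally show "(\<integral>\<^sup>+ y. ennreal (norm (h (Complex t y))) \<partial>lborel) \<le> M + M" .
    qed (use x sum xu in \<open>auto simp: s_def\<close>)
    moreover have "s - x = x'" "s - u = u'" using sum by (auto simp: s_def)
    ultimately show ?thesis by (simp add: h_eq)
  qed
  show ?thesis
    using le[OF x sum] le[of u u' x x'] x sum by (cases "x \<le> u") auto
qed

text \<open>
  Write \<open>E x\<close> for the squared norm of the trace \<open>f\<^sub>x\<close> of \<open>f\<close> on \<open>Re z = x\<close>. Since inner products of traces depend on the sum of
  the abscissas only, the squared distance of \<open>f\<^sub>x\<close> and \<open>f\<^sub>t\<close> is
  \<open>E x + E t - 2 * E ((x + t) / 2)\<close>. Hence \<open>E\<close> is midpoint convex, so it has a limit at \<open>0\<close>, and the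
  same identity then says that the traces form a Cauchy family.
\<close>

lemma hardy2_strip_has_boundary_value:
  assumes f: "f \<in> hardy2_strip b" and b: "0 < b"
  shows "\<exists>g. is_boundary_value f g"
proof -
  define E where "E = (\<lambda>x. Re (LINT y|lborel. f (Complex x y) * cnj (f (Complex x y))))"
  obtain M where M: "M < \<infinity>" "\<And>x. 0 < x \<Longrightarrow> x < b \<Longrightarrow> sq_norm (\<lambda>y. f (Complex x y)) \<le> M"
    using hardy2_strip_bound[OF f] by blast
  note meas = hardy2_strip_measurable[OF f] and fin = hardy2_strip_sq_norm_finite[OF f]
  have zero: "sq_norm (\<lambda>y. 0) = 0" by (simp add: sq_norm_def)
  have E: "sq_norm (\<lambda>y. f (Complex x y)) = ennreal (E x)" "0 \<le> E x" if "0 < x" "x < b" for x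
    using sq_norm_diff_eq[OF meas[OF that] _ fin[OF that], of "\<lambda>_. 0"] by (simp_all add: E_def zero)
  have mid: "Re (LINT y|lborel. f (Complex x y) * cnj (f (Complex x' y))) = E ((x + x') / 2)"
    if "0 < x" "x < b" "0 < x'" "x' < b" for x x'
    unfolding E_def using that by (subst hardy2_strip_inner_shift[OF f, of x x' "(x + x') / 2" "(x + x') / 2"]) auto
  have diff: "sq_norm (\<lambda>y. f (Complex x y) - f (Complex x' y)) = ennreal (E x + E x' - 2 * E ((x + x') / 2))"
    "0 \<le> E x + E x' - 2 * E ((x + x') / 2)"
    if "0 < x" "x < b" "0 < x'" "x' < b" for x x'
    using sq_norm_diff_eq[OF meas meas fin fin, of x x'] that mid[OF that] by (simp_all add: E_def)
  have "\<exists>L. \<forall>e>0. \<exists>\<eta>>0. \<eta> \<le> b \<and> (\<forall>x. 0 < x \<and> x < \<eta> \<longrightarrow> \<bar>E x - L\<bar> \<le> e)"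
  proof (rule midpoint_convex_bounded_tendsto[OF b])
    fix x assume x: "0 < x" "x < b"
    have "enn2real (ennreal (E x)) \<le> enn2real M"
      using M(2)[OF x] M(1) unfolding E(1)[OF x] by (intro enn2real_mono) auto
    then show "0 \<le> E x \<and> E x \<le> enn2real M" using E(2)[OF x] by simp
  qed (use diff(2) in force)
  then obtain L where L: "\<And>e. 0 < e \<Longrightarrow> \<exists>\<eta>>0. \<eta> \<le> b \<and> (\<forall>x. 0 < x \<and> x < \<eta> \<longrightarrow> \<bar>E x - L\<bar> \<le> e)" by blast
  have "\<exists>g \<in> L2 lborel. ((\<lambda>x. sq_norm (\<lambda>y. f (Complex x y) - g y)) \<longlongrightarrow> 0) (at_right 0)"
  proof (rule L2_Cauchy_imp_limit[OF b meas fin])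
    fix e :: real assume "0 < e"
    then obtain \<eta> where \<eta>: "\<eta> > 0" "\<eta> \<le> b" "\<And>x. 0 < x \<Longrightarrow> x < \<eta> \<Longrightarrow> \<bar>E x - L\<bar> \<le> e / 4"
      using L[of "e / 4"] by auto
    show "\<exists>\<eta>>0. \<forall>x x'. 0 < x \<and> x < \<eta> \<and> 0 < x' \<and> x' < \<eta> \<longrightarrow>
        sq_norm (\<lambda>y. f (Complex x y) - f (Complex x' y)) \<le> ennreal e"
    proof (intro exI[of _ \<eta>] conjI allI impI)
      fix x x' assume x: "0 < x \<and> x < \<eta> \<and> 0 < x' \<and> x' < \<eta>"
      have "\<bar>E x - L\<bar> \<le> e / 4" "\<bar>E x' - L\<bar> \<le> e / 4" "\<bar>E ((x + x') / 2) - L\<bar> \<le> e / 4"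
        using x \<eta>(3)[of x] \<eta>(3)[of x'] \<eta>(3)[of "(x + x') / 2"] by auto
      then have "E x + E x' - 2 * E ((x + x') / 2) \<le> e" by linarith
      then show "sq_norm (\<lambda>y. f (Complex x y) - f (Complex x' y)) \<le> ennreal e"
        using x \<eta>(2) by (subst diff(1)) (auto intro: ennreal_leI)
    qed (use \<eta> in auto)
  qed auto
  then show ?thesis unfolding is_boundary_value_def sq_norm_def by blast
qed

lemma boundary_value_limit:
  assumes "f \<in> hardy2_strip b" "0 < b"
  shows "boundary_value f \<in> borel_measurable borel" "sq_norm (boundary_value f) < \<infinity>"
    "((\<lambda>x. sq_norm (\<lambda>y. f (Complex x y) - boundary_value f y)) \<longlongrightarrow> 0) (at_right 0)"
  using someI_ex[OF hardy2_strip_has_boundary_value[OF assms]]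
  unfolding boundary_value_def is_boundary_value_def L2_def sq_norm_def by auto

section \<open>The Gamma function on vertical lines\<close>

lemma norm_Gamma_le_Gamma_Re:
  assumes "0 < Re s"
  shows "norm (Gamma s) \<le> Gamma (Re s)"
proof -
  have c: "((\<lambda>t. of_real t powr (s - 1) / of_real (exp t)) has_integral Gamma s) {0..}"
    by (rule Gamma_integral_complex[OF assms])
  have r: "((\<lambda>t. t powr (Re s - 1) / exp t) has_integral Gamma (Re s)) {0..}"
    by (rule Gamma_integral_real[OF assms])
  have "norm (integral {0..} (\<lambda>t. of_real t powr (s - 1) / of_real (exp t))) \<le> integral {0..} (\<lambda>t. t powr (Re s - 1) / exp t)"
    using c r by (intro integral_norm_bound_integral) (auto simp: integrable_on_def norm_divide norm_powr_real_powr)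
  then show ?thesis using c r by (simp add: integral_unique)
qed

lemma Re_pos_not_nonpos_Int: "0 < Re s \<Longrightarrow> s \<notin> \<int>\<^sub>\<le>\<^sub>0"
  by (auto elim!: nonpos_Ints_cases)

text \<open>
  One step of the functional equation \<open>Gamma (s + 1) = s * Gamma s\<close> gives enough decay to be square
  integrable on vertical lines, locally uniformly in the abscissa.
\<close>

lemma norm_Gamma_decay:
  assumes "0 < \<alpha>"
  obtains C where "0 \<le> C" "\<And>s. \<alpha> \<le> Re s \<Longrightarrow> Re s \<le> \<beta> \<Longrightarrow> norm (Gamma s) \<le> C / norm (Complex \<alpha> (Im s))"
proof -
  have "continuous_on {\<alpha> + 1..\<beta> + 1} (Gamma :: real \<Rightarrow> real)"
    using assms by (intro continuous_on_Gamma) (auto elim!: nonpos_Ints_cases)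
  then have "bounded (Gamma ` {\<alpha> + 1..\<beta> + 1 :: real})"
    by (intro compact_imp_bounded compact_continuous_image) auto
  then obtain C where C: "\<And>x::real. \<alpha> + 1 \<le> x \<Longrightarrow> x \<le> \<beta> + 1 \<Longrightarrow> \<bar>Gamma x\<bar> \<le> C"
    unfolding bounded_iff by fastforce
  show thesis
  proof (rule that)
    show "0 \<le> max C 0" by simp
    fix s assume s: "\<alpha> \<le> Re s" "Re s \<le> \<beta>"
    have s0: "s \<noteq> 0" using s assms by auto
    have "s \<notin> \<int>\<^sub>\<le>\<^sub>0" using s assms by (intro Re_pos_not_nonpos_Int) simp
    then have "norm s * norm (Gamma s) = norm (Gamma (s + 1))" by (simp add: Gamma_plus1 norm_mult)
    also have "\<dots> \<le> Gamma (Re s + 1)" using norm_Gamma_le_Gamma_Re[of "s + 1"] s assms by simp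
    also have "\<dots> \<le> max C 0" using C[of "Re s + 1"] s by simp
    finally have "norm (Gamma s) \<le> max C 0 / norm s" using s0 by (simp add: field_simps)
    also have "\<dots> \<le> max C 0 / norm (Complex \<alpha> (Im s))"
    proof (intro divide_left_mono mult_pos_pos)
      show "norm (Complex \<alpha> (Im s)) \<le> norm s"
        using s assms by (simp add: cmod_def power_mono)
    qed (use s0 assms in \<open>auto simp: complex_eq_iff\<close>)
    finally show "norm (Gamma s) \<le> max C 0 / norm (Complex \<alpha> (Im s))" .
  qed
qed

lemma borel_measurable_inverse_line:
  assumes "0 < \<alpha>"
  shows "(\<lambda>y. C / norm (Complex \<alpha> (t + e * y))) \<in> borel_measurable borel"
  using assms
  by (intro borel_measurable_continuous_onI) (auto simp: Complex_eq complex_eq_iff intro!: continuous_intros)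

lemma sq_norm_inverse_line:
  assumes "0 < \<alpha>" "e \<noteq> 0"
  shows "sq_norm (\<lambda>y. of_real (C / norm (Complex \<alpha> (t + e * y)))) < \<infinity>"
proof -
  have "integrable lborel (\<lambda>x::real. inverse (1 + x^2))"
    using integrable_inverse_1_plus_square by (simp add: set_integrable_def)
  then have int: "integrable lborel (\<lambda>x. C^2 * (max 1 (1 / \<alpha>^2) * inverse (1 + x^2)))" by simp
  have "sq_norm (\<lambda>y. of_real (C / norm (Complex \<alpha> y))) \<le> (\<integral>\<^sup>+ y. ennreal (C^2 * (max 1 (1 / \<alpha>^2) * inverse (1 + y^2))) \<partial>lborel)"
    unfolding sq_norm_def
  proof (intro nn_integral_mono ennreal_leI)
    fix y :: real
    define m where "m = max 1 (1 / \<alpha>^2)"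
    have m: "1 \<le> m" "1 \<le> m * \<alpha>^2" using assms by (auto simp: m_def field_simps max_def)
    then have "1 + y^2 \<le> m * (\<alpha>^2 + y^2)"
      using mult_right_mono[OF m(1), of "y^2"] by (simp add: algebra_simps)
    then have "1 / (\<alpha>^2 + y^2) \<le> m * inverse (1 + y^2)"
      using assms by (simp add: field_simps add_pos_nonneg)
    then have "C^2 * (1 / (\<alpha>^2 + y^2)) \<le> C^2 * (m * inverse (1 + y^2))"
      by (intro mult_left_mono) auto
    then show "(norm (complex_of_real (C / norm (Complex \<alpha> y))))\<^sup>2 \<le> C^2 * (max 1 (1 / \<alpha>^2) * inverse (1 + y^2))"
      by (simp add: power_divide cmod_power2 m_def)
  qed
  also have "\<dots> < \<infinity>"
    using int by (subst nn_integral_eq_integral) auto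
  finally have "\<infinity> > sq_norm (\<lambda>y. of_real (C / norm (Complex \<alpha> y)))" .
  also have "sq_norm (\<lambda>y. of_real (C / norm (Complex \<alpha> y))) = ennreal \<bar>e\<bar> * sq_norm (\<lambda>y. of_real (C / norm (Complex \<alpha> (t + e * y))))"
    unfolding sq_norm_def using borel_measurable_inverse_line[OF assms(1), of C 0 1]
    by (intro nn_integral_real_affine assms(2)) simp
  finally show ?thesis
    using assms(2) by (auto simp: ennreal_mult_less_top top.not_eq_extremum ennreal_eq_0_iff)
qed

text \<open>
  The reproducing kernel as a function of the single variable \<open>s = z + cnj w\<close>.
\<close>

definition gamma_kernel :: "complex \<Rightarrow> complex" where
  "gamma_kernel s = 1 / (2 * of_real pi) * (Gamma s / 2 powr s)"

lemma two_powr_eq_exp: "(2::complex) powr s = exp (s * of_real (ln 2))"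
  by (simp add: powr_def Ln_of_real[of 2, simplified])

lemma holomorphic_gamma_kernel: "gamma_kernel holomorphic_on {s. 0 < Re s}"
  unfolding gamma_kernel_def two_powr_eq_exp
  by (intro holomorphic_intros) (auto dest: Re_pos_not_nonpos_Int)

lemma cnj_gamma_kernel: "cnj (gamma_kernel s) = gamma_kernel (cnj s)"
  by (simp add: gamma_kernel_def two_powr_eq_exp cnj_Gamma exp_cnj)

lemma norm_two_powr: "norm ((2::complex) powr s) = 2 powr Re s"
  using norm_powr_real_powr[of 2 s] by simp

lemma norm_gamma_kernel_le:
  assumes "0 < Re s"
  shows "norm (gamma_kernel s) \<le> norm (Gamma s) / 2 powr Re s"
proof -
  have "1 \<le> 2 * pi" using pi_ge_two by linarith
  then have "1 / (2 * pi) * (norm (Gamma s) / 2 powr Re s) \<le> 1 * (norm (Gamma s) / 2 powr Re s)"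
    by (intro mult_right_mono) auto
  then show ?thesis by (simp add: gamma_kernel_def norm_mult norm_divide norm_two_powr)
qed

lemma gamma_kernel_decay:
  assumes "0 < \<alpha>"
  obtains C where "\<And>s. \<alpha> \<le> Re s \<Longrightarrow> Re s \<le> \<beta> \<Longrightarrow> norm (gamma_kernel s) \<le> C / norm (Complex \<alpha> (Im s))"
proof -
  obtain C where C: "0 \<le> C" "\<And>s. \<alpha> \<le> Re s \<Longrightarrow> Re s \<le> \<beta> \<Longrightarrow> norm (Gamma s) \<le> C / norm (Complex \<alpha> (Im s))"
    using norm_Gamma_decay[OF assms] by blast
  show thesis
  proof (rule that)
    fix s assume s: "\<alpha> \<le> Re s" "Re s \<le> \<beta>"
    have "norm (gamma_kernel s) \<le> norm (Gamma s) / 2 powr Re s" using s assms by (intro norm_gamma_kernel_le) simp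
    also have "\<dots> \<le> norm (Gamma s) / 1"
      using s assms ge_one_powr_ge_zero[of 2 "Re s"] by (intro divide_left_mono) auto
    also have "\<dots> \<le> C / norm (Complex \<alpha> (Im s))" using C(2)[OF s] by simp
    finally show "norm (gamma_kernel s) \<le> C / norm (Complex \<alpha> (Im s))" .
  qed
qed

lemma borel_measurable_gamma_kernel_line:
  assumes "0 < \<sigma>"
  shows "(\<lambda>y. gamma_kernel (Complex \<sigma> (t + e * y))) \<in> borel_measurable borel"
  by (intro borel_measurable_continuous_onI continuous_on_compose2[OF holomorphic_on_imp_continuous_on[OF holomorphic_gamma_kernel]])
     (use assms in \<open>auto simp: Complex_eq intro!: continuous_intros\<close>)

text \<open>
  On lines with abscissas in a compact interval, a single square integrable function dominates the
  kernel. The affine argument \<open>t + e * y\<close> covers both \<open>z + cnj w\<close> (\<open>e = 1\<close>) and the conjugate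
  kernel, which on the line through \<open>z\<close> has the argument \<open>v - z\<close> (\<open>e = - 1\<close>).
\<close>

lemma gamma_kernel_line_dominated:
  assumes "0 < \<alpha>" "e \<noteq> 0"
  obtains v :: "real \<Rightarrow> real" where "v \<in> borel_measurable borel" "sq_norm (\<lambda>y. of_real (v y)) < \<infinity>"
    "\<And>\<sigma> y. \<alpha> \<le> \<sigma> \<Longrightarrow> \<sigma> \<le> \<beta> \<Longrightarrow> norm (gamma_kernel (Complex \<sigma> (t + e * y))) \<le> v y"
proof -
  obtain C where C: "\<And>s. \<alpha> \<le> Re s \<Longrightarrow> Re s \<le> \<beta> \<Longrightarrow> norm (gamma_kernel s) \<le> C / norm (Complex \<alpha> (Im s))"
    using gamma_kernel_decay[OF assms(1)] by blast
  show thesis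
  proof (rule that)
    show "(\<lambda>y. C / norm (Complex \<alpha> (t + e * y))) \<in> borel_measurable borel"
      by (rule borel_measurable_inverse_line[OF assms(1)])
    show "sq_norm (\<lambda>y. of_real (C / norm (Complex \<alpha> (t + e * y)))) < \<infinity>"
      by (rule sq_norm_inverse_line[OF assms])
  next
    fix \<sigma> y assume "\<alpha> \<le> \<sigma>" "\<sigma> \<le> \<beta>"
    then show "norm (gamma_kernel (Complex \<sigma> (t + e * y))) \<le> C / norm (Complex \<alpha> (t + e * y))"
      using C[of "Complex \<sigma> (t + e * y)"] by simp
  qed
qed

lemma gamma_kernel_line_bound:
  assumes "0 < \<alpha>" "e \<noteq> 0"
  obtains M where "M < \<infinity>" "\<And>\<sigma>. \<alpha> \<le> \<sigma> \<Longrightarrow> \<sigma> \<le> \<beta> \<Longrightarrow> sq_norm (\<lambda>y. gamma_kernel (Complex \<sigma> (t + e * y))) \<le> M"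
proof -
  obtain v where v: "sq_norm (\<lambda>y. of_real (v y)) < \<infinity>"
    "\<And>\<sigma> y. \<alpha> \<le> \<sigma> \<Longrightarrow> \<sigma> \<le> \<beta> \<Longrightarrow> norm (gamma_kernel (Complex \<sigma> (t + e * y))) \<le> v y"
    using gamma_kernel_line_dominated[OF assms] by blast
  show thesis
  proof (rule that[OF v(1)])
    fix \<sigma> assume s: "\<alpha> \<le> \<sigma>" "\<sigma> \<le> \<beta>"
    show "sq_norm (\<lambda>y. gamma_kernel (Complex \<sigma> (t + e * y))) \<le> sq_norm (\<lambda>y. of_real (v y))"
      unfolding sq_norm_def using v(2)[OF s]
      by (intro nn_integral_mono ennreal_leI power_mono) (auto intro: order_trans[OF _ abs_ge_self])
  qed
qed

text \<open>
  The source of the weights \<open>2 ^ n / n!\<close>: up to the common factor \<open>2 powr (- a)\<close> the summands are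
  \<open>Gamma (a + n) / n!\<close>, and these sums telescope to \<open>Gamma (a + N + 1) / (a * N!)\<close>. The result
  has a simple pole at \<open>a = 0\<close>, and all its other poles have moved to \<open>Re a \<le> - (N + 1)\<close>.
\<close>

lemma sum_gamma_kernel:
  assumes a: "0 < Re a"
  shows "(\<Sum>n\<le>N. 2^n / fact n * gamma_kernel (a + of_nat n)) = 2 ^ Suc N / fact N * gamma_kernel (a + of_nat (Suc N)) / a"
proof -
  have a0: "a \<noteq> 0" using a by auto
  have powr: "2 ^ n * gamma_kernel (a + of_nat n) = Gamma (a + of_nat n) / (2 * of_real pi * 2 powr a)" for n
    by (simp add: gamma_kernel_def powr_add powr_nat)
  have G: "(\<Sum>n\<le>N. Gamma (a + of_nat n) / fact n) = Gamma (a + of_nat (Suc N)) / (a * fact N)"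
  proof (induction N)
    case 0
    then show ?case using a0 Gamma_plus1[OF Re_pos_not_nonpos_Int[OF a]] by simp
  next
    case (Suc N)
    have "Gamma (a + of_nat (Suc (Suc N))) = (a + of_nat (Suc N)) * Gamma (a + of_nat (Suc N))"
      using Gamma_plus1[OF Re_pos_not_nonpos_Int, of "a + of_nat (Suc N)"] a by (simp add: algebra_simps)
    moreover have "(of_nat (Suc N) :: complex) \<noteq> 0" by (simp del: of_nat_Suc)
    ultimately show ?case using a0 Suc.IH by (simp add: field_simps del: of_nat_Suc)
  qed
  have "(\<Sum>n\<le>N. 2^n / fact n * gamma_kernel (a + of_nat n)) = (\<Sum>n\<le>N. Gamma (a + of_nat n) / fact n / (2 * of_real pi * 2 powr a))"
    using powr by (intro sum.cong) (auto simp: field_simps)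
  also have "\<dots> = (\<Sum>n\<le>N. Gamma (a + of_nat n) / fact n) / (2 * of_real pi * 2 powr a)"
    by (simp add: sum_divide_distrib)
  also have "\<dots> = (2 ^ Suc N * gamma_kernel (a + of_nat (Suc N))) / (a * fact N)"
    unfolding G powr by simp
  finally show ?thesis by (simp add: field_simps)
qed

section \<open>The kernel functions and their boundary values\<close>

lemma gamma_kernel_translate_hardy2:
  assumes w: "0 < Re w"
  shows "(\<lambda>z. gamma_kernel (z + cnj w)) \<in> hardy2_strip b"
proof -
  obtain M where M: "M < \<infinity>" "\<And>\<sigma>. Re w \<le> \<sigma> \<Longrightarrow> \<sigma> \<le> Re w + b \<Longrightarrow> sq_norm (\<lambda>y. gamma_kernel (Complex \<sigma> (- Im w + 1 * y))) \<le> M"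
    using gamma_kernel_line_bound[OF w, of 1 "Re w + b"] by (metis zero_neq_one)
  have eq: "Complex x y + cnj w = Complex (Re w + x) (- Im w + 1 * y)" for x y by (simp add: complex_eq_iff)
  have "(SUP x\<in>{0<..<b}. \<integral>\<^sup>+ y. ennreal ((norm (gamma_kernel (Complex x y + cnj w)))\<^sup>2) \<partial>lborel) \<le> M"
    unfolding eq sq_norm_def[symmetric] by (intro SUP_least M(2)) auto
  moreover have "(gamma_kernel \<circ> (\<lambda>z. z + cnj w)) holomorphic_on strip b"
    using w by (intro holomorphic_on_compose_gen[OF _ holomorphic_gamma_kernel]) (auto simp: strip_def intro!: holomorphic_intros)
  ultimately show ?thesis using M(1) by (auto simp: hardy2_strip_def o_def le_less_trans)
qed

lemma sequence_at_right_0: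
  assumes "0 < (b::real)"
  obtains X :: "nat \<Rightarrow> real" where "\<And>k. 0 < X k" "\<And>k. X k < b" "filterlim X (at_right 0) sequentially"
proof
  show "0 < b / real (k + 2)" "b / real (k + 2) < b" for k
    using assms by (auto simp: field_simps intro!: add_pos_nonneg)
  have "(\<lambda>k. b / real (k + 2)) \<longlonglongrightarrow> 0"
    by (rule LIMSEQ_ignore_initial_segment[OF lim_const_over_n])
  then show "filterlim (\<lambda>k. b / real (k + 2)) (at_right 0) sequentially"
    using assms by (intro filterlim_at_withinI[of _ 0]) (auto intro!: always_eventually)
qed

text \<open>
  If \<open>f\<close> also converges pointwise at the boundary, then the \<open>L\<^sup>2\<close> boundary value is the pointwise limit, by
  the Fatou lemma.
\<close>

lemma boundary_value_AE_eq:
  assumes f: "f \<in> hardy2_strip b" and b: "0 < b"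
    and g [measurable]: "g \<in> borel_measurable borel"
    and lim: "\<And>y. ((\<lambda>x. f (Complex x y)) \<longlongrightarrow> g y) (at_right 0)"
  shows "AE y in lborel. boundary_value f y = g y"
proof -
  note bv = boundary_value_limit[OF f b]
  have [measurable]: "boundary_value f \<in> borel_measurable borel" by (rule bv)
  obtain X where X: "\<And>k. 0 < X k" "\<And>k. X k < b" and X0: "filterlim X (at_right 0) sequentially"
    using sequence_at_right_0[of b] b by blast
  note [measurable] = hardy2_strip_measurable[OF f X]
  have "sq_norm (\<lambda>y. g y - boundary_value f y) = (\<integral>\<^sup>+ y. liminf (\<lambda>k. ennreal ((norm (f (Complex (X k) y) - boundary_value f y))\<^sup>2)) \<partial>lborel)"
    unfolding sq_norm_def
  proof (intro nn_integral_cong lim_imp_Liminf[symmetric] tendsto_ennrealI tendsto_intros)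
    fix y show "(\<lambda>k. f (Complex (X k) y)) \<longlonglongrightarrow> g y"
      by (rule filterlim_compose[OF lim X0])
  qed auto
  also have "\<dots> \<le> liminf (\<lambda>k. sq_norm (\<lambda>y. f (Complex (X k) y) - boundary_value f y))"
    unfolding sq_norm_def by (rule nn_integral_liminf) measurable
  also have "\<dots> = 0"
    by (intro lim_imp_Liminf filterlim_compose[OF bv(3) X0]) auto
  finally have "(\<integral>\<^sup>+ y. ennreal ((norm (g y - boundary_value f y))\<^sup>2) \<partial>lborel) = 0" by (simp add: sq_norm_def)
  then have "AE y in lborel. ennreal ((norm (g y - boundary_value f y))\<^sup>2) = 0"
    by (subst (asm) nn_integral_0_iff_AE) measurable
  then show ?thesis by eventually_elim auto
qed

lemma gamma_kernel_translate_boundary_value: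
  assumes w: "0 < Re w"
  shows "AE y in lborel. boundary_value (\<lambda>z. gamma_kernel (z + cnj w)) y = gamma_kernel (Complex 0 y + cnj w)"
proof (rule boundary_value_AE_eq[OF gamma_kernel_translate_hardy2[OF w] zero_less_one])
  have eq: "Complex x y + cnj w = Complex (Re w + x) (- Im w + 1 * y)" for x y by (simp add: complex_eq_iff)
  show "(\<lambda>y. gamma_kernel (Complex 0 y + cnj w)) \<in> borel_measurable borel"
    unfolding eq using w by (intro borel_measurable_gamma_kernel_line) simp
  fix y
  have "isCont gamma_kernel (Complex 0 y + cnj w)"
    using w holomorphic_on_imp_continuous_on[OF holomorphic_gamma_kernel]
    by (intro continuous_on_interior[of "{s. 0 < Re s}"]) (auto simp: interior_open open_halfspace_Re_gt)
  moreover have "((\<lambda>x. Complex x y + cnj w) \<longlongrightarrow> Complex 0 y + cnj w) (at_right 0)"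
    unfolding Complex_eq by (intro tendsto_intros)
  ultimately show "((\<lambda>x. gamma_kernel (Complex x y + cnj w)) \<longlongrightarrow> gamma_kernel (Complex 0 y + cnj w)) (at_right 0)"
    by (rule isCont_tendsto_compose)
qed

section \<open>Moving the kernel integrals to a common line\<close>

lemma reflected_line: "v - Complex x y = Complex (Re v - x) (Im v + (-1) * y)"
  by (simp add: complex_eq_iff)

lemma hardy2_times_gamma_kernel_integrable:
  assumes f: "f \<in> hardy2_strip b" and x: "0 < x" "x < b" "x < Re v"
  shows "integrable lborel (\<lambda>y. f (Complex x y) * gamma_kernel (v - Complex x y))"
proof -
  obtain M where M: "M < \<infinity>" "\<And>\<sigma>. Re v - x \<le> \<sigma> \<Longrightarrow> \<sigma> \<le> Re v - x \<Longrightarrow> sq_norm (\<lambda>y. gamma_kernel (Complex \<sigma> (Im v + (-1) * y))) \<le> M"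
    using gamma_kernel_line_bound[of "Re v - x" "-1" "Re v - x" "Im v"] x by auto
  show ?thesis
    unfolding reflected_line
  proof (rule integrable_mult_sq_norm[OF hardy2_strip_measurable[OF f x(1,2)] _ hardy2_strip_sq_norm_finite[OF f x(1,2)]])
    show "sq_norm (\<lambda>y. gamma_kernel (Complex (Re v - x) (Im v + (-1) * y))) < \<infinity>"
      using M(2)[of "Re v - x"] M(1) by (auto intro: le_less_trans)
  qed (use x in \<open>intro borel_measurable_gamma_kernel_line; simp\<close>)
qed

lemma holomorphic_gamma_kernel_reflected: "(\<lambda>z. gamma_kernel (v - z)) holomorphic_on {z. Re z < Re v}"
proof -
  have "(gamma_kernel \<circ> (\<lambda>z. v - z)) holomorphic_on {z. Re z < Re v}"
    by (intro holomorphic_on_compose_gen[OF _ holomorphic_gamma_kernel]) (auto intro!: holomorphic_intros)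
  then show ?thesis by (simp add: o_def)
qed

lemma hardy2_times_gamma_kernel_bound:
  assumes f: "f \<in> hardy2_strip b" and cd: "0 < c" "d < b" "d < Re v"
  obtains M where "M < \<infinity>"
    "\<And>x. c \<le> x \<Longrightarrow> x \<le> d \<Longrightarrow> (\<integral>\<^sup>+ y. ennreal (norm (f (Complex x y) * gamma_kernel (v - Complex x y))) \<partial>lborel) \<le> M"
proof -
  obtain M1 where M1: "M1 < \<infinity>" "\<And>x. 0 < x \<Longrightarrow> x < b \<Longrightarrow> sq_norm (\<lambda>y. f (Complex x y)) \<le> M1"
    using hardy2_strip_bound[OF f] by blast
  obtain M2 where M2: "M2 < \<infinity>" "\<And>\<sigma>. Re v - d \<le> \<sigma> \<Longrightarrow> \<sigma> \<le> Re v - c \<Longrightarrow> sq_norm (\<lambda>y. gamma_kernel (Complex \<sigma> (Im v + (-1) * y))) \<le> M2"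
    using gamma_kernel_line_bound[of "Re v - d" "-1" "Re v - c" "Im v"] cd by auto
  show thesis
  proof (rule that)
    show "M1 + M2 < \<infinity>" using M1 M2 by simp
    fix x assume x: "c \<le> x" "x \<le> d"
    have "(\<integral>\<^sup>+ y. ennreal (norm (f (Complex x y) * gamma_kernel (v - Complex x y))) \<partial>lborel)
      \<le> sq_norm (\<lambda>y. f (Complex x y)) + sq_norm (\<lambda>y. gamma_kernel (Complex (Re v - x) (Im v + (-1) * y)))"
      unfolding reflected_line using x cd
      by (intro nn_integral_mult_le_sq_norm hardy2_strip_measurable[OF f] borel_measurable_gamma_kernel_line) auto
    also have "\<dots> \<le> M1 + M2" using x cd by (intro add_mono M1 M2) auto
    finally show "(\<integral>\<^sup>+ y. ennreal (norm (f (Complex x y) * gamma_kernel (v - Complex x y))) \<partial>lborel) \<le> M1 + M2" .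
  qed
qed

lemma gamma_kernel_integral_shift:
  assumes f: "f \<in> hardy2_strip b" and cd: "0 < c" "c \<le> d" "d < b" "d < Re v"
  shows "(LINT y|lborel. f (Complex c y) * gamma_kernel (v - Complex c y)) = (LINT y|lborel. f (Complex d y) * gamma_kernel (v - Complex d y))"
proof -
  obtain M where M: "M < \<infinity>"
    "\<And>x. c \<le> x \<Longrightarrow> x \<le> d \<Longrightarrow> (\<integral>\<^sup>+ y. ennreal (norm (f (Complex x y) * gamma_kernel (v - Complex x y))) \<partial>lborel) \<le> M"
    using hardy2_times_gamma_kernel_bound[OF f cd(1,3,4)] by blast
  have "(\<lambda>z. f z * gamma_kernel (v - z)) holomorphic_on {z. 0 < Re z \<and> Re z < min b (Re v)}"
    by (intro holomorphic_on_mult holomorphic_on_subset[OF hardy2_strip_holomorphic[OF f]]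
        holomorphic_on_subset[OF holomorphic_gamma_kernel_reflected]) auto
  from vertical_line_shift[OF this _ _ _ M(1), of c d] M(2) cd show ?thesis by simp
qed

text \<open>
  The shift of lines up to the imaginary axis. The integral over \<open>Re z = x\<close> does not depend on
  \<open>x\<close>; as \<open>x \<rightarrow> 0\<close> the factor \<open>f\<close> converges to its boundary value in \<open>L\<^sup>2\<close> while the kernel stays
  bounded in \<open>L\<^sup>2\<close> (the part \<open>A\<close>), and the kernel converges dominatedly (the part \<open>B\<close>).
\<close>

lemma gamma_kernel_integral_boundary:
  assumes f: "f \<in> hardy2_strip b" and c: "0 < c" "c < b" "c < Re v"
  shows "(LINT y|lborel. f (Complex c y) * gamma_kernel (v - Complex c y)) = (LINT y|lborel. boundary_value f y * gamma_kernel (v - Complex 0 y))"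
proof -
  have b: "0 < b" using c by simp
  note bv = boundary_value_limit[OF f b]
  have [measurable]: "boundary_value f \<in> borel_measurable borel" by (rule bv)
  obtain X where X: "\<And>k. 0 < X k" "\<And>k. X k < c" and X0: "filterlim X (at_right 0) sequentially"
    using sequence_at_right_0[of c] c by blast
  then have X0': "X \<longlonglongrightarrow> 0" by (simp add: filterlim_at)
  define G where "G = (\<lambda>x y. gamma_kernel (v - Complex x y))"
  have Gm [measurable]: "G x \<in> borel_measurable borel" if "x < Re v" for x
    unfolding G_def reflected_line using that by (intro borel_measurable_gamma_kernel_line) simp
  have [measurable]: "(\<lambda>y. f (Complex (X k) y)) \<in> borel_measurable borel" "G (X k) \<in> borel_measurable borel" for k
    using X[of k] c by (auto intro!: hardy2_strip_measurable[OF f] Gm)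
  obtain u where u [measurable]: "u \<in> borel_measurable borel" and uf: "sq_norm (\<lambda>y. of_real (u y)) < \<infinity>"
    and Gu': "\<And>\<sigma> y. Re v - c \<le> \<sigma> \<Longrightarrow> \<sigma> \<le> Re v \<Longrightarrow> norm (gamma_kernel (Complex \<sigma> (Im v + (-1) * y))) \<le> u y"
    using gamma_kernel_line_dominated[of "Re v - c" "-1" "Re v" "Im v"] c by auto
  have Gu: "norm (G x y) \<le> u y" if "0 \<le> x" "x \<le> c" for x y
    unfolding G_def reflected_line using that by (intro Gu') auto
  have Gf: "sq_norm (G x) \<le> sq_norm (\<lambda>y. of_real (u y))" if "0 \<le> x" "x \<le> c" for x
    unfolding sq_norm_def using Gu[OF that]
    by (intro nn_integral_mono ennreal_leI power_mono) (auto intro: order_trans[OF _ abs_ge_self])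
  define A where "A = (\<lambda>k. LINT y|lborel. (f (Complex (X k) y) - boundary_value f y) * G (X k) y)"
  define B where "B = (\<lambda>k. LINT y|lborel. boundary_value f y * G (X k) y)"
  have diff_fin: "sq_norm (\<lambda>y. f (Complex (X k) y) - boundary_value f y) < \<infinity>" for k
  proof -
    have "sq_norm (\<lambda>y. f (Complex (X k) y) + - boundary_value f y) \<le> 2 * sq_norm (\<lambda>y. f (Complex (X k) y)) + 2 * sq_norm (\<lambda>y. - boundary_value f y)"
      by (rule sq_norm_add_le) measurable
    also have "\<dots> < \<infinity>"
      using hardy2_strip_sq_norm_finite[OF f, of "X k"] X[of k] c bv(2)
      by (simp add: sq_norm_def ennreal_mult_less_top)
    finally show ?thesis by simp
  qed
  have Gfin: "sq_norm (G (X k)) < \<infinity>" for k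
    using Gf[of "X k"] X[of k] uf by (auto intro: le_less_trans)
  have split: "(LINT y|lborel. f (Complex c y) * gamma_kernel (v - Complex c y)) = A k + B k" for k
  proof -
    have "(LINT y|lborel. f (Complex c y) * gamma_kernel (v - Complex c y)) = (LINT y|lborel. f (Complex (X k) y) * G (X k) y)"
      unfolding G_def using X[of k] c by (intro gamma_kernel_integral_shift[OF f, symmetric]) auto
    also have "\<dots> = (LINT y|lborel. (f (Complex (X k) y) - boundary_value f y) * G (X k) y + boundary_value f y * G (X k) y)"
      by (simp add: algebra_simps)
    also have "\<dots> = A k + B k"
      unfolding A_def B_def using diff_fin Gfin bv(2)
      by (intro Bochner_Integration.integral_add integrable_mult_sq_norm) auto
    finally show ?thesis .
  qed
  have "A \<longlonglongrightarrow> 0"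
  proof -
    have le: "ennreal ((norm (A k))\<^sup>2) \<le> sq_norm (\<lambda>y. f (Complex (X k) y) - boundary_value f y) * sq_norm (\<lambda>y. of_real (u y))" for k
    proof -
      have "ennreal ((norm (A k))\<^sup>2) \<le> sq_norm (\<lambda>y. f (Complex (X k) y) - boundary_value f y) * sq_norm (G (X k))"
        unfolding A_def using diff_fin Gfin by (intro norm_inner_le_sq_norm) auto
      also have "\<dots> \<le> sq_norm (\<lambda>y. f (Complex (X k) y) - boundary_value f y) * sq_norm (\<lambda>y. of_real (u y))"
        using X[of k] by (intro mult_left_mono Gf) auto
      finally show ?thesis .
    qed
    have "(\<lambda>k. sq_norm (\<lambda>y. f (Complex (X k) y) - boundary_value f y) * sq_norm (\<lambda>y. of_real (u y))) \<longlonglongrightarrow> 0 * sq_norm (\<lambda>y. of_real (u y))"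
      using uf by (intro tendsto_mult_ennreal filterlim_compose[OF bv(3) X0] tendsto_const) auto
    then have lim: "(\<lambda>k. sq_norm (\<lambda>y. f (Complex (X k) y) - boundary_value f y) * sq_norm (\<lambda>y. of_real (u y))) \<longlonglongrightarrow> 0"
      by simp
    have "(\<lambda>k. ennreal ((norm (A k))\<^sup>2)) \<longlonglongrightarrow> 0"
      by (rule tendsto_sandwich[OF _ always_eventually[OF allI[OF le]] tendsto_const lim]) simp
    then have "(\<lambda>k. ennreal ((norm (A k))\<^sup>2)) \<longlonglongrightarrow> ennreal 0" by simp
    then have "(\<lambda>k. (norm (A k))\<^sup>2) \<longlonglongrightarrow> 0" by (rule tendsto_ennrealD) auto
    then have "(\<lambda>k. sqrt ((norm (A k))\<^sup>2)) \<longlonglongrightarrow> sqrt 0" by (rule tendsto_real_sqrt)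
    then show ?thesis by (simp add: tendsto_norm_zero_iff)
  qed
  moreover have "B \<longlonglongrightarrow> (LINT y|lborel. boundary_value f y * G 0 y)"
    unfolding B_def
  proof (rule integral_dominated_convergence)
    show "integrable lborel (\<lambda>y. norm (boundary_value f y * of_real (u y)))"
      using uf bv(2) by (intro integrable_norm integrable_mult_sq_norm) auto
    show "AE y in lborel. (\<lambda>k. boundary_value f y * G (X k) y) \<longlonglongrightarrow> boundary_value f y * G 0 y"
    proof (intro AE_I2 tendsto_intros)
      fix y
      have "isCont gamma_kernel (v - Complex 0 y)"
        using c holomorphic_on_imp_continuous_on[OF holomorphic_gamma_kernel]
        by (intro continuous_on_interior[of "{s. 0 < Re s}"]) (auto simp: interior_open open_halfspace_Re_gt)
      moreover have "(\<lambda>k. v - Complex (X k) y) \<longlonglongrightarrow> v - Complex 0 y"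
        unfolding Complex_eq using X0' by (intro tendsto_intros) 
      ultimately show "(\<lambda>k. G (X k) y) \<longlonglongrightarrow> G 0 y"
        unfolding G_def by (rule isCont_tendsto_compose)
    qed
    show "AE y in lborel. norm (boundary_value f y * G (X k) y) \<le> norm (boundary_value f y * of_real (u y))" for k
      using Gu X[of k] by (intro AE_I2) (auto simp: norm_mult intro!: mult_left_mono order_trans[OF _ abs_ge_self])
  qed (use c in \<open>auto intro!: borel_measurable_times\<close>)
  ultimately have "(\<lambda>k. A k + B k) \<longlonglongrightarrow> 0 + (LINT y|lborel. boundary_value f y * G 0 y)"
    by (rule tendsto_add)
  then have "(\<lambda>k. LINT y|lborel. f (Complex c y) * gamma_kernel (v - Complex c y)) \<longlonglongrightarrow> (LINT y|lborel. boundary_value f y * G 0 y)"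
    by (simp add: split[symmetric])
  then show ?thesis by (simp add: LIMSEQ_const_iff G_def)
qed

section \<open>The reproducing property\<close>

text \<open>
  The summands of \<^const>\<open>inner_omega\<close>. Convergence of their series is part of what has to be shown, so statements
  about \<open>sums\<close> are preferred to statements about \<^const>\<open>inner_omega\<close>, whose value carries no information for
  a divergent series.
\<close>

definition omega_term :: "(complex \<Rightarrow> complex) \<Rightarrow> (complex \<Rightarrow> complex) \<Rightarrow> nat \<Rightarrow> complex" where
  "omega_term f g n = 2 ^ n / fact n *
     (LINT y|lborel. bd_extend f (Complex (real n / 2) y) * cnj (bd_extend g (Complex (real n / 2) y)))"

lemma inner_omega_eq_suminf: "inner_omega f g = suminf (omega_term f g)"
  unfolding inner_omega_def omega_term_def ..

lemma cnj_omega_term: "cnj (omega_term f g n) = omega_term g f n"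
proof -
  have "cnj (LINT y|lborel. bd_extend f (Complex (real n / 2) y) * cnj (bd_extend g (Complex (real n / 2) y)))
      = (LINT y|lborel. cnj (bd_extend f (Complex (real n / 2) y) * cnj (bd_extend g (Complex (real n / 2) y))))"
    by (rule Bochner_Integration.integral_cnj[symmetric])
  then show ?thesis by (simp add: omega_term_def mult.commute)
qed

lemma bd_extend_line:
  "bd_extend f (Complex (real 0 / 2) y) = boundary_value f y"
  "0 < n \<Longrightarrow> bd_extend f (Complex (real n / 2) y) = f (Complex (real n / 2) y)"
  by (simp_all add: bd_extend_def)

lemma cnj_gamma_kernel_line: "cnj (gamma_kernel (Complex (real n / 2) y + cnj w)) = gamma_kernel (w + of_nat n - Complex (real n / 2) y)"
proof -
  have "cnj (Complex (real n / 2) y + cnj w) = w + of_nat n - Complex (real n / 2) y" by (simp add: complex_eq_iff)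
  then show ?thesis by (simp only: cnj_gamma_kernel)
qed

text \<open>
  The terms live on the different lines \<open>Re z = n / 2\<close>. The conjugate kernel continues to
  \<open>gamma_kernel (w + n - z)\<close>, whose poles satisfy \<open>Re z \<ge> Re w + n > n / 2\<close>; so each line can be moved left to
  one common line \<open>Re z = c\<close> without crossing a pole. For \<open>n = 0\<close> it is moved right from the
  imaginary axis, which is where \<open>c < Re w\<close> and the boundary values are used.
\<close>

lemma omega_term_gamma_kernel:
  assumes f: "\<And>b. 0 < b \<Longrightarrow> f \<in> hardy2_strip b"
    and c: "0 < c" "c < 1 / 2" "c < Re w"
  shows "omega_term f (\<lambda>z. gamma_kernel (z + cnj w)) n =
    (LINT y|lborel. f (Complex c y) * (2 ^ n / fact n * gamma_kernel (w - Complex c y + of_nat n)))"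
proof -
  have "(LINT y|lborel. bd_extend f (Complex (real n / 2) y) * cnj (bd_extend (\<lambda>z. gamma_kernel (z + cnj w)) (Complex (real n / 2) y)))
    = (LINT y|lborel. f (Complex c y) * gamma_kernel (w + of_nat n - Complex c y))"
  proof (cases "n = 0")
    case True
    have w: "0 < Re w" using c by simp
    have "(LINT y|lborel. boundary_value f y * cnj (boundary_value (\<lambda>z. gamma_kernel (z + cnj w)) y)) =
        (LINT y|lborel. boundary_value f y * gamma_kernel (w - Complex 0 y))"
    proof (rule integral_cong_AE)
      show "AE y in lborel. boundary_value f y * cnj (boundary_value (\<lambda>z. gamma_kernel (z + cnj w)) y) = boundary_value f y * gamma_kernel (w - Complex 0 y)"
        using gamma_kernel_translate_boundary_value[OF w]
        by eventually_elim (use cnj_gamma_kernel_line[of 0 _ w] in simp)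
      have "(\<lambda>y. gamma_kernel (w - Complex 0 y)) \<in> borel_measurable borel"
        unfolding reflected_line using w by (intro borel_measurable_gamma_kernel_line) simp
      then show "(\<lambda>y. boundary_value f y * gamma_kernel (w - Complex 0 y)) \<in> borel_measurable lborel"
        using boundary_value_limit(1)[OF f[of 1]] by (auto intro: borel_measurable_times)
      show "(\<lambda>y. boundary_value f y * cnj (boundary_value (\<lambda>z. gamma_kernel (z + cnj w)) y)) \<in> borel_measurable lborel"
        using boundary_value_limit(1)[OF f[of 1]] boundary_value_limit(1)[OF gamma_kernel_translate_hardy2[OF w] zero_less_one]
        by (auto intro: borel_measurable_times borel_measurable_cnj)
    qed
    also have "\<dots> = (LINT y|lborel. f (Complex c y) * gamma_kernel (w - Complex c y))"
      using c by (intro gamma_kernel_integral_boundary[symmetric, of f 1] f) auto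
    finally show ?thesis using True bd_extend_line(1) by simp
  next
    case False
    have "0 < Re (Complex (real n / 2) y)" for y using False by simp
    then have "(LINT y|lborel. bd_extend f (Complex (real n / 2) y) * cnj (bd_extend (\<lambda>z. gamma_kernel (z + cnj w)) (Complex (real n / 2) y)))
      = (LINT y|lborel. f (Complex (real n / 2) y) * gamma_kernel (w + of_nat n - Complex (real n / 2) y))"
      using False by (simp only: bd_extend_line(2)[of n] cnj_gamma_kernel_line neq0_conv)
    also have "\<dots> = (LINT y|lborel. f (Complex c y) * gamma_kernel (w + of_nat n - Complex c y))"
      using False c f[of "real n"] by (intro gamma_kernel_integral_shift[symmetric, of f "real n"]) (auto intro: less_le_trans[of c "1/2"])
    finally show ?thesis .
  qed
  then show ?thesis
    by (simp add: omega_term_def algebra_simps flip: integral_mult_right_zero)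
qed

text \<open>
  On the common line the partial sum is evaluated by \<open>sum_gamma_kernel\<close>. Its closed form has only
  the pole at \<open>z = w\<close> left of \<open>Re z = Re w + N + 1\<close>, and moving the line from \<open>Re z = c\<close> to
  \<open>Re z = Re w + 1\<close> picks up \<open>f w\<close> there.
\<close>

lemma omega_term_gamma_kernel_partial_sum:
  assumes f: "\<And>b. 0 < b \<Longrightarrow> f \<in> hardy2_strip b" and w: "0 < Re w" and N: "0 < N"
  shows "(\<Sum>n\<le>N. omega_term f (\<lambda>z. gamma_kernel (z + cnj w)) n) = f w -
    2 ^ Suc N / fact N * (LINT y|lborel. f (Complex (Re w + 1) y) * gamma_kernel (w + of_nat (Suc N) - Complex (Re w + 1) y) / Complex 1 (y - Im w))"
proof -
  \<comment> \<open>left of all lines n/2 with n > 0 and of the pole at w\<close>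
  define c where "c = min (1 / 4) (Re w / 2)"
  have c: "0 < c" "c < 1 / 2" "c < Re w" using w by (auto simp: c_def)
  define C where "C = (2 ^ Suc N / fact N :: complex)"
  define k where "k = (\<lambda>z. f z * gamma_kernel (w + of_nat (Suc N) - z))"
  have "(\<Sum>n\<le>N. omega_term f (\<lambda>z. gamma_kernel (z + cnj w)) n) =
    (\<Sum>n\<le>N. LINT y|lborel. f (Complex c y) * (2 ^ n / fact n * gamma_kernel (w - Complex c y + of_nat n)))"
    by (intro sum.cong refl omega_term_gamma_kernel f c)
  also have "\<dots> = (LINT y|lborel. (\<Sum>n\<le>N. f (Complex c y) * (2 ^ n / fact n * gamma_kernel (w - Complex c y + of_nat n))))"
  proof (rule Bochner_Integration.integral_sum[symmetric])
    fix n
    have "integrable lborel (\<lambda>y. f (Complex c y) * gamma_kernel (w + of_nat n - Complex c y))"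
      using c by (intro hardy2_times_gamma_kernel_integrable[OF f[of 1]]) auto
    from integrable_mult_right[OF this, of "2 ^ n / fact n"]
    show "integrable lborel (\<lambda>y. f (Complex c y) * (2 ^ n / fact n * gamma_kernel (w - Complex c y + of_nat n)))"
      by (simp add: algebra_simps)
  qed
  also have "\<dots> = (LINT y|lborel. - C * (k (Complex c y) / (Complex c y - w)))"
  proof (rule Bochner_Integration.integral_cong)
    fix y
    define a where "a = w - Complex c y"
    have a: "0 < Re a" using c by (simp add: a_def)
    have "(\<Sum>n\<le>N. f (Complex c y) * (2 ^ n / fact n * gamma_kernel (a + of_nat n))) = f (Complex c y) * (C * gamma_kernel (a + of_nat (Suc N)) / a)"
      unfolding sum_distrib_left[symmetric] sum_gamma_kernel[OF a] C_def ..
    also have "a + of_nat (Suc N) = w + of_nat (Suc N) - Complex c y" by (simp add: a_def)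
    also have "f (Complex c y) * (C * gamma_kernel (w + of_nat (Suc N) - Complex c y) / a) = - C * (k (Complex c y) / (- a))"
      by (simp add: k_def)
    also have "- a = Complex c y - w" by (simp add: a_def)
    finally show "(\<Sum>n\<le>N. f (Complex c y) * (2 ^ n / fact n * gamma_kernel (w - Complex c y + of_nat n))) = - C * (k (Complex c y) / (Complex c y - w))"
      unfolding a_def .
  qed simp
  also have "\<dots> = - C * (LINT y|lborel. k (Complex c y) / (Complex c y - w))"
    by (rule integral_mult_right_zero)
  also have "(LINT y|lborel. k (Complex c y) / (Complex c y - w)) =
      (LINT y|lborel. k (Complex (Re w + 1) y) / (Complex (Re w + 1) y - w)) - 2 * of_real pi * k w"
  proof -
    have fH: "f \<in> hardy2_strip (Re w + real (Suc N))" using w by (intro f) simp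
    have "k holomorphic_on {z. 0 < Re z \<and> Re z < Re w + real (Suc N)}"
      unfolding k_def
      by (intro holomorphic_on_mult holomorphic_on_subset[OF hardy2_strip_holomorphic[OF fH]]
        holomorphic_on_subset[OF holomorphic_gamma_kernel_reflected]) auto
    moreover obtain M where M: "M < \<infinity>"
      "\<And>x. c \<le> x \<Longrightarrow> x \<le> Re w + 1 \<Longrightarrow> (\<integral>\<^sup>+ y. ennreal (norm (k (Complex x y))) \<partial>lborel) \<le> M"
      unfolding k_def
      using hardy2_times_gamma_kernel_bound[OF fH c(1), of "Re w + 1" "w + of_nat (Suc N)"] N by auto
    ultimately have "(LINT y|lborel. k (Complex (Re w + 1) y) / (Complex (Re w + 1) y - w)) -
        (LINT y|lborel. k (Complex c y) / (Complex c y - w)) = 2 * of_real pi * k w"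
      using N c by (intro vertical_line_residue[of k 0 "Re w + real (Suc N)" c w "Re w + 1" M]) auto
    then show ?thesis by (simp add: algebra_simps)
  qed
  also have "- C * ((LINT y|lborel. k (Complex (Re w + 1) y) / (Complex (Re w + 1) y - w)) - 2 * of_real pi * k w)
     = C * (2 * of_real pi * k w) - C * (LINT y|lborel. k (Complex (Re w + 1) y) / (Complex (Re w + 1) y - w))"
    by (simp add: algebra_simps)
  also have "C * (2 * of_real pi * k w) = f w"
  proof -
    have "gamma_kernel (of_nat (Suc N)) = fact N / (2 * of_real pi * 2 ^ Suc N)"
    proof -
      have "(2::complex) powr (of_nat (Suc N)) = 2 ^ Suc N" by (subst powr_nat') auto
      moreover have "Gamma (of_nat (Suc N) :: complex) = fact N" using Gamma_fact[of N, where 'a = complex] by (simp add: add.commute)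
      ultimately show ?thesis by (simp only: gamma_kernel_def) simp
    qed
    then have "k w = f w * (fact N / (2 * of_real pi * 2 ^ Suc N))" by (simp add: k_def)
    then show ?thesis by (simp add: C_def)
  qed
  also have "(\<lambda>y. Complex (Re w + 1) y - w) = (\<lambda>y. Complex 1 (y - Im w))" by (simp add: complex_eq_iff fun_eq_iff)
  then have "(LINT y|lborel. k (Complex (Re w + 1) y) / (Complex (Re w + 1) y - w)) = (LINT y|lborel. k (Complex (Re w + 1) y) / Complex 1 (y - Im w))"
    by (simp add: fun_eq_iff)
  finally show ?thesis by (simp add: k_def C_def)
qed

text \<open>
  On the line \<open>Re z = Re w + 1\<close> the argument of the kernel has real part exactly \<open>N\<close>. Compared
  with the factor \<open>N!\<close> in the denominator of the remainder this gains \<open>1 / N\<close>.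
\<close>

lemma norm_gamma_kernel_line_le:
  assumes "0 < N"
  shows "norm (gamma_kernel (w + of_nat (Suc N) - Complex (Re w + 1) y)) \<le> fact (N - 1) / 2 ^ N"
proof -
  define s where "s = w + of_nat (Suc N) - Complex (Re w + 1) y"
  have s: "Re s = real N" by (simp add: s_def)
  have "norm (gamma_kernel s) \<le> norm (Gamma s) / 2 powr Re s" using s assms by (intro norm_gamma_kernel_le) simp
  also have "\<dots> \<le> Gamma (Re s) / 2 powr Re s"
    using s assms by (intro divide_right_mono norm_Gamma_le_Gamma_Re) auto
  also have "\<dots> = fact (N - 1) / 2 ^ N"
    using assms Gamma_fact[of "N - 1", where 'a = real] by (simp add: s powr_realpow)
  finally show ?thesis by (simp add: s_def)
qed

lemma omega_term_gamma_kernel_sums: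
  assumes f: "\<And>b. 0 < b \<Longrightarrow> f \<in> hardy2_strip b" and w: "0 < Re w"
  shows "omega_term f (\<lambda>z. gamma_kernel (z + cnj w)) sums f w"
proof -
  define r where "r = (\<lambda>y. f (Complex (Re w + 1) y) * of_real (1 / norm (Complex 1 (y - Im w))))"
  have fH: "f \<in> hardy2_strip (Re w + 2)" using w by (intro f) simp
  have r: "integrable lborel r"
    unfolding r_def
  proof (rule integrable_mult_sq_norm)
    show "(\<lambda>y. f (Complex (Re w + 1) y)) \<in> borel_measurable borel" using w by (intro hardy2_strip_measurable[OF fH]) auto
    show "sq_norm (\<lambda>y. f (Complex (Re w + 1) y)) < \<infinity>" using w by (intro hardy2_strip_sq_norm_finite[OF fH]) auto
    show "sq_norm (\<lambda>y. of_real (1 / norm (Complex 1 (y - Im w)))) < \<infinity>"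
      using sq_norm_inverse_line[of 1 1 1 "- Im w"] by simp
    show "(\<lambda>y. complex_of_real (1 / norm (Complex 1 (y - Im w)))) \<in> borel_measurable borel"
      using borel_measurable_inverse_line[of 1 1 "- Im w" 1] by simp
  qed
  define R where "R = (LINT y|lborel. norm (r y))"
  have bound: "norm ((\<Sum>n\<le>N. omega_term f (\<lambda>z. gamma_kernel (z + cnj w)) n) - f w) \<le> 2 * R * (1 / real N)" if N: "0 < N" for N
  proof -
    define u where "u = (\<lambda>y. f (Complex (Re w + 1) y) * gamma_kernel (w + of_nat (Suc N) - Complex (Re w + 1) y) / Complex 1 (y - Im w))"
    have eq: "(\<Sum>n\<le>N. omega_term f (\<lambda>z. gamma_kernel (z + cnj w)) n) = f w - 2 ^ Suc N / fact N * (LINT y|lborel. u y)"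
      unfolding u_def by (rule omega_term_gamma_kernel_partial_sum[OF f w N])
    have "norm (LINT y|lborel. u y) \<le> (LINT y|lborel. fact (N - 1) / 2 ^ N * norm (r y))"
    proof (rule order_trans[OF integral_norm_bound integral_mono'])
      show "integrable lborel (\<lambda>y. fact (N - 1) / 2 ^ N * norm (r y))" using r by simp
      fix y
      have "norm (u y) = norm (gamma_kernel (w + of_nat (Suc N) - Complex (Re w + 1) y)) * norm (r y)"
        by (simp add: u_def r_def norm_mult norm_divide)
      also have "\<dots> \<le> fact (N - 1) / 2 ^ N * norm (r y)"
        by (intro mult_right_mono norm_gamma_kernel_line_le[OF N]) auto
      finally show "norm (u y) \<le> fact (N - 1) / 2 ^ N * norm (r y)" .
    qed auto
    also have "\<dots> = fact (N - 1) / 2 ^ N * R" by (simp add: R_def)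
    finally have u: "norm (LINT y|lborel. u y) \<le> fact (N - 1) / 2 ^ N * R" .
    have "norm ((\<Sum>n\<le>N. omega_term f (\<lambda>z. gamma_kernel (z + cnj w)) n) - f w) = 2 ^ Suc N / fact N * norm (LINT y|lborel. u y)"
      by (subst eq) (simp add: norm_mult norm_divide norm_power)
    also have "\<dots> \<le> 2 ^ Suc N / fact N * (fact (N - 1) / 2 ^ N * R)"
      by (intro mult_left_mono u) auto
    also have "\<dots> = 2 * R * (1 / real N)"
      using N by (cases N) (simp_all add: field_simps del: of_nat_Suc)
    finally show ?thesis .
  qed
  have "(\<lambda>N. 2 * R * (1 / real N)) \<longlonglongrightarrow> 2 * R * 0" by (intro tendsto_intros lim_1_over_n)
  then have lim: "(\<lambda>N. 2 * R * (1 / real N)) \<longlonglongrightarrow> 0" by simp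
  have "(\<lambda>N. (\<Sum>n\<le>N. omega_term f (\<lambda>z. gamma_kernel (z + cnj w)) n) - f w) \<longlonglongrightarrow> 0"
    by (rule Lim_null_comparison[OF _ lim]) (use bound in \<open>auto intro!: eventually_sequentiallyI[of 1]\<close>)
  then show ?thesis by (simp add: sums_def_le LIM_zero_iff)
qed

section \<open>Membership of the kernel functions\<close>

lemma borel_measurable_bd_extend:
  assumes f: "f holomorphic_on right_halfplane" and b: "boundary_value f \<in> borel_measurable borel"
  shows "bd_extend f \<in> borel_measurable borel"
proof -
  have Re: "(Re :: complex \<Rightarrow> real) \<in> borel_measurable borel" "(Im :: complex \<Rightarrow> real) \<in> borel_measurable borel"
    by (auto intro!: borel_measurable_continuous_onI continuous_intros)
  have op: "open right_halfplane" by (simp add: right_halfplane_def open_halfspace_Re_gt)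
  have 1: "(\<lambda>z. indicator right_halfplane z *\<^sub>R f z) \<in> borel_measurable borel"
    using op by (intro borel_measurable_continuous_on_indicator holomorphic_on_imp_continuous_on f) auto
  have "{z. Re z = 0} \<in> sets borel" using Re(1) by (intro borel_closed closed_Collect_eq continuous_intros)
  then have 2: "(\<lambda>z. indicator {z. Re z = 0} z *\<^sub>R boundary_value f (Im z)) \<in> borel_measurable borel"
    using measurable_compose[OF Re(2) b] by (intro borel_measurable_scaleR borel_measurable_indicator) auto
  have "bd_extend f = (\<lambda>z. indicator right_halfplane z *\<^sub>R f z + indicator {z. Re z = 0} z *\<^sub>R boundary_value f (Im z))"
    by (auto simp: bd_extend_def right_halfplane_def fun_eq_iff)
  then show ?thesis using borel_measurable_add[OF 1 2] by simp
qed

lemma bd_extend_line_L2: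
  assumes f: "\<And>b. 0 < b \<Longrightarrow> f \<in> hardy2_strip b"
  shows "(\<lambda>y. bd_extend f (Complex (real n / 2) y)) \<in> borel_measurable borel"
    "sq_norm (\<lambda>y. bd_extend f (Complex (real n / 2) y)) < \<infinity>"
proof -
  have "(\<lambda>y. bd_extend f (Complex (real n / 2) y)) \<in> borel_measurable borel \<and> sq_norm (\<lambda>y. bd_extend f (Complex (real n / 2) y)) < \<infinity>"
  proof (cases "n = 0")
    case True
    then show ?thesis using boundary_value_limit(1,2)[OF f[OF zero_less_one] zero_less_one] by (simp add: bd_extend_def)
  next
    case False
    have "f \<in> hardy2_strip (real n)" using False by (intro f) simp
    from hardy2_strip_measurable[OF this, of "real n / 2"] hardy2_strip_sq_norm_finite[OF this, of "real n / 2"]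
    show ?thesis using False by (simp add: bd_extend_def)
  qed
  then show "(\<lambda>y. bd_extend f (Complex (real n / 2) y)) \<in> borel_measurable borel"
    "sq_norm (\<lambda>y. bd_extend f (Complex (real n / 2) y)) < \<infinity>" by auto
qed

text \<open>
  Finiteness of the norm comes for free: the reproducing formula uses only the Hardy condition on strips, so it
  applies to the kernel function \<open>k\<close> itself. Its terms are the nonnegative summands of the squared norm, and
  it says that they sum to \<open>k w\<close>.
\<close>

lemma gamma_kernel_translate_in_M2_omega:
  assumes w: "0 < Re w"
  shows "(\<lambda>z. gamma_kernel (z + cnj w)) \<in> M2_omega"
proof -
  define k where "k = (\<lambda>z. gamma_kernel (z + cnj w))"
  have H: "k \<in> hardy2_strip b" for b unfolding k_def by (rule gamma_kernel_translate_hardy2[OF w])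
  have "(gamma_kernel \<circ> (\<lambda>z. z + cnj w)) holomorphic_on right_halfplane"
    using w by (intro holomorphic_on_compose_gen[OF _ holomorphic_gamma_kernel]) (auto simp: right_halfplane_def intro!: holomorphic_intros)
  then have hol: "k holomorphic_on right_halfplane" by (simp add: k_def o_def)
  have meas [measurable]: "bd_extend k \<in> borel_measurable borel"
    by (rule borel_measurable_bd_extend[OF hol boundary_value_limit(1)[OF H zero_less_one]])
  have sums: "(\<lambda>n. Re (omega_term k k n)) sums Re (k w)"
    using sums_Re[OF omega_term_gamma_kernel_sums[OF H w]] unfolding k_def[symmetric] .
  have zero: "sq_norm (\<lambda>y. 0) = 0" by (simp add: sq_norm_def)
  have n: "ennreal (2 ^ n / fact n) * sq_norm (\<lambda>y. bd_extend k (Complex (real n / 2) y)) = ennreal (Re (omega_term k k n))"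
      "0 \<le> Re (omega_term k k n)" for n
  proof -
    define u where "u = (\<lambda>y. bd_extend k (Complex (real n / 2) y))"
    have u: "u \<in> borel_measurable borel" "sq_norm u < \<infinity>" unfolding u_def using bd_extend_line_L2[OF H] by auto
    have 1: "sq_norm u = ennreal (Re (LINT y|lborel. u y * cnj (u y)))" "0 \<le> Re (LINT y|lborel. u y * cnj (u y))"
      using sq_norm_diff_eq[OF u(1) _ u(2), of "\<lambda>_. 0"] by (simp_all add: zero)
    have "omega_term k k n = of_real (2 ^ n / fact n) * (LINT y|lborel. u y * cnj (u y))"
      by (simp add: omega_term_def u_def)
    then have 2: "Re (omega_term k k n) = 2 ^ n / fact n * Re (LINT y|lborel. u y * cnj (u y))"
      by (simp only: times_complex.sel Re_complex_of_real Im_complex_of_real mult_zero_left diff_zero)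
    show "ennreal (2 ^ n / fact n) * sq_norm (\<lambda>y. bd_extend k (Complex (real n / 2) y)) = ennreal (Re (omega_term k k n))"
      unfolding u_def[symmetric] 2 1(1) by (rule ennreal_mult[symmetric]) (use 1 in auto)
    show "0 \<le> Re (omega_term k k n)" unfolding 2 using 1(2) by simp
  qed
  have "(\<integral>\<^sup>+ z. ennreal ((norm (bd_extend k z))\<^sup>2) \<partial>omega) = (\<Sum>n. ennreal (Re (omega_term k k n)))"
    by (subst nn_integral_omega) (simp_all add: n(1)[symmetric] sq_norm_def)
  also have "\<dots> = ennreal (Re (k w))" by (rule suminf_ennreal_eq[OF n(2) sums])
  finally have "bd_extend k \<in> L2 omega"
    using meas by (simp add: L2_def omega_def cong: measurable_cong_sets)
  then show ?thesis using hol H by (simp add: M2_omega_def k_def)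
qed

section \<open>Independence of values outside the half-plane\<close>

text \<open>
  A boundary value only depends on the values in the open half-plane. This allows \<open>K\<close> to be
  arbitrary elsewhere.
\<close>

lemma boundary_value_cong:
  assumes "\<And>z. z \<in> right_halfplane \<Longrightarrow> f z = g z"
  shows "boundary_value f = boundary_value g"
proof -
  have "is_boundary_value f h \<longleftrightarrow> is_boundary_value g h" for h
  proof -
    have "((\<lambda>x. \<integral>\<^sup>+ y. ennreal ((norm (f (Complex x y) - h y))\<^sup>2) \<partial>lborel) \<longlongrightarrow> 0) (at_right 0) \<longleftrightarrow>
      ((\<lambda>x. \<integral>\<^sup>+ y. ennreal ((norm (g (Complex x y) - h y))\<^sup>2) \<partial>lborel) \<longlongrightarrow> 0) (at_right 0)"
      by (rule tendsto_cong, rule eventually_at_rightI[of 0 1]) (auto simp: assms right_halfplane_def)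
    then show ?thesis by (simp add: is_boundary_value_def)
  qed
  then show ?thesis by (simp add: boundary_value_def)
qed

lemma bd_extend_cong:
  assumes "\<And>z. z \<in> right_halfplane \<Longrightarrow> f z = g z"
  shows "bd_extend f = bd_extend g"
  using boundary_value_cong[OF assms] assms by (auto simp: bd_extend_def right_halfplane_def fun_eq_iff)

lemma hardy2_strip_cong:
  assumes "\<And>z. z \<in> right_halfplane \<Longrightarrow> f z = g z"
  shows "f \<in> hardy2_strip b \<longleftrightarrow> g \<in> hardy2_strip b"
proof -
  have "f holomorphic_on strip b \<longleftrightarrow> g holomorphic_on strip b"
    using assms by (intro holomorphic_cong) (auto simp: strip_def right_halfplane_def)
  moreover have "(SUP x\<in>{0<..<b}. \<integral>\<^sup>+ y. ennreal ((norm (f (Complex x y)))\<^sup>2) \<partial>lborel) =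
      (SUP x\<in>{0<..<b}. \<integral>\<^sup>+ y. ennreal ((norm (g (Complex x y)))\<^sup>2) \<partial>lborel)"
    using assms by (intro SUP_cong) (auto simp: right_halfplane_def)
  ultimately show ?thesis by (simp add: hardy2_strip_def)
qed

lemma M2_omega_cong:
  assumes "\<And>z. z \<in> right_halfplane \<Longrightarrow> f z = g z"
  shows "f \<in> M2_omega \<longleftrightarrow> g \<in> M2_omega"
  using holomorphic_cong[OF refl assms] hardy2_strip_cong[OF assms] bd_extend_cong[OF assms]
  by (auto simp: M2_omega_def)

lemma gamma_kernel_reproduces:
  assumes "f \<in> M2_omega" "w \<in> right_halfplane"
  shows "omega_term f (\<lambda>z. gamma_kernel (z + cnj w)) sums f w"
  using assms by (intro omega_term_gamma_kernel_sums) (auto simp: M2_omega_def right_halfplane_def)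

section \<open>The characterisation of the reproducing kernel\<close>

theorem theorem3:
  fixes K :: "complex \<Rightarrow> complex \<Rightarrow> complex"
  shows "is_reproducing_kernel K \<longleftrightarrow>
    (\<forall>z\<in>right_halfplane. \<forall>w\<in>right_halfplane.
       K z w = 1 / (2 * of_real pi) * (Gamma (z + cnj w) / 2 powr (z + cnj w)))"
  unfolding gamma_kernel_def[symmetric]
proof
  assume K: "is_reproducing_kernel K"
  show "\<forall>z\<in>right_halfplane. \<forall>w\<in>right_halfplane. K z w = gamma_kernel (z + cnj w)"
  proof (intro ballI)
    fix z w assume z: "z \<in> right_halfplane" and w: "w \<in> right_halfplane"
    let ?k = "\<lambda>u. gamma_kernel (u + cnj z)"
    have k: "?k \<in> M2_omega" using z by (intro gamma_kernel_translate_in_M2_omega) (simp add: right_halfplane_def)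
    have Kw: "(\<lambda>u. K u w) \<in> M2_omega" "inner_omega ?k (\<lambda>u. K u w) = gamma_kernel (w + cnj z)"
      using K w k by (auto simp: is_reproducing_kernel_def)
    \<comment> \<open>evaluate the inner product of the two kernels once with each of them reproducing, and compare by conjugation\<close>
    have "omega_term (\<lambda>u. K u w) ?k sums K z w" by (rule gamma_kernel_reproduces[OF Kw(1) z])
    then have "(\<lambda>n. cnj (omega_term (\<lambda>u. K u w) ?k n)) sums cnj (K z w)" by (simp add: sums_cnj)
    then have "inner_omega ?k (\<lambda>u. K u w) = cnj (K z w)"
      unfolding cnj_omega_term inner_omega_eq_suminf by (simp add: sums_iff)
    then have "K z w = cnj (gamma_kernel (w + cnj z))" using Kw(2) by simp
    then show "K z w = gamma_kernel (z + cnj w)" by (simp add: cnj_gamma_kernel add.commute)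
  qed
next
  assume K: "\<forall>z\<in>right_halfplane. \<forall>w\<in>right_halfplane. K z w = gamma_kernel (z + cnj w)"
  show "is_reproducing_kernel K"
    unfolding is_reproducing_kernel_def
  proof (intro ballI conjI)
    fix w assume w: "w \<in> right_halfplane"
    have eq: "K z w = gamma_kernel (z + cnj w)" if "z \<in> right_halfplane" for z using K w that by blast
    show "(\<lambda>z. K z w) \<in> M2_omega"
      using M2_omega_cong[of "\<lambda>z. K z w", OF eq] gamma_kernel_translate_in_M2_omega w by (simp add: right_halfplane_def)
    fix f assume f: "f \<in> M2_omega"
    have "inner_omega f (\<lambda>z. K z w) = inner_omega f (\<lambda>z. gamma_kernel (z + cnj w))"
      unfolding inner_omega_def by (simp add: bd_extend_cong[of "\<lambda>z. K z w", OF eq])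
    also have "\<dots> = f w"
      using gamma_kernel_reproduces[OF f w] by (simp add: inner_omega_eq_suminf sums_iff)
    finally show "f w = inner_omega f (\<lambda>z. K z w)" ..
  qed
qed

end
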